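(* Let $a_\alpha,b_\beta,c_\gamma,d\in C^\infty(\mathbb R,\mathbb C)$ ($0\le\alpha\le m$, $0\le\beta\le n$, $0\le\gamma\le k$) with $a_m(x)\neq 0$ for all $x\in\mathbb R$. Then $$\{\lambda\in\mathbb C:\ \mathcal A-\lambda\text{ is not Douglis--Nirenberg elliptic}\}\subset\sigma_{\rm ess}(\mathcal A).$$
   Context: Let $D:=-\mathrm i\,\mathrm d/\mathrm dx$ and let $n,k$ be non-negative integers such that $m:=n+k$ is a positive even integer. In $L^2(\mathbb R)\oplus L^2(\mathbb R)$ consider $$\mathcal A_0:=\begin{pmatrix}\sum_{\alpha=0}^m a_\alpha D^\alpha & \sum_{\beta=0}^n b_\beta D^\beta\\ \sum_{\gamma=0}^k c_\gamma D^\gamma & d\end{pmatrix},\qquad \mathrm{Dom}(\mathcal A_0):=C_0^\infty(\mathbb R)\oplus C_0^\infty(\mathbb R),$$ which is closable; $\mathcal A$ denotes its closure. For $\lambda\in\mathbb C$, $\mathcal A-\lambda$ is called elliptic in the sense of Douglis and Nirenberg (on the real line) if and only if $\det M_\lambda(x,\xi)\neq0$ for all $x\in\mathbb R$ and all $\xi\in\mathbb R\setminus\{0\}$, where $$M_\lambda(x,\xi):=\begin{pmatrix}a_m(x)\xi^m & b_n(x)\xi^n\\ c_k(x)\xi^k & d(x)-\lambda\end{pmatrix}.$$ One has $\det M_\lambda(x,\xi)=a_m(x)(\Delta(x)-\lambda)\xi^m$ with $\Delta:=d-b_nc_k/a_m$. For a closed densely defined operator $T$, $\sigma_{\rm ess}(T):=\{\mu\in\mathbb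 C: T-\mu\text{ is not Fredholm}\}$, where Fredholm means closed range, finite-dimensional kernel and finite-codimensional range. *)

theory Defs
  imports "HOL-Analysis.Analysis"
begin

class complex_normed_vector = real_normed_vector +
  fixes scaleC :: "complex \<Rightarrow> 'a \<Rightarrow> 'a" (infixr "*\<^sub>C" 75)
  assumes scaleC_add_right: "c *\<^sub>C (x + y) = c *\<^sub>C x + c *\<^sub>C y"
    and scaleC_add_left: "(c + c') *\<^sub>C x = c *\<^sub>C x + c' *\<^sub>C x"
    and scaleC_scaleC: "c *\<^sub>C c' *\<^sub>C x = (c * c') *\<^sub>C x"
    and scaleC_of_real: "complex_of_real r *\<^sub>C x = r *\<^sub>R x"
    and norm_scaleC: "norm (c *\<^sub>C x) = cmod c * norm x"

global_interpretation complex_vector: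
  vector_space "scaleC :: complex \<Rightarrow> 'a \<Rightarrow> 'a :: complex_normed_vector"
proof
  show "1 *\<^sub>C x = x" for x :: 'a
    using scaleC_of_real[of 1 x] by simp
qed (simp_all add: scaleC_add_right scaleC_add_left scaleC_scaleC)

text \<open>The inherited norm on \<^typ>\<open>'a \<times> 'b\<close> is \<open>sqrt (\<parallel>x\<parallel>\<^sup>2 + \<parallel>y\<parallel>\<^sup>2)\<close>,
  i.e. the one of the Hilbert space direct sum.\<close>

instantiation prod :: (complex_normed_vector, complex_normed_vector) complex_normed_vector
begin

definition scaleC_prod :: "complex \<Rightarrow> 'a \<times> 'b \<Rightarrow> 'a \<times> 'b" where
  "c *\<^sub>C p = (c *\<^sub>C fst p, c *\<^sub>C snd p)"

instance
proof
  fix c c' :: complex and r :: real and x y :: "'a \<times> 'b"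
  show "norm (c *\<^sub>C x) = cmod c * norm x"
    by (simp add: scaleC_prod_def norm_prod_def norm_scaleC power_mult_distrib
        flip: distrib_left) (simp add: real_sqrt_mult)
qed (auto simp: scaleC_prod_def scaleC_add_right scaleC_add_left scaleC_scaleC
      scaleC_of_real prod_eq_iff)

end

text \<open>An unbounded operator in \<open>'h\<close> is identified with its graph, so the closure of a closable
  operator is the operator whose graph is the topological closure of the given graph.\<close>

type_synonym 'h operator = "('h \<times> 'h) set"

definition op_closure :: "'h :: complex_normed_vector operator \<Rightarrow> 'h operator" where
  "op_closure T = closure T"

definition op_shift :: "'h :: complex_normed_vector operator \<Rightarrow> complex \<Rightarrow> 'h operator" where
  "op_shift T \<mu> = {(x, y - \<mu> *\<^sub>C x) | x y. (x, y) \<in> T}"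

definition op_kernel :: "'h :: complex_normed_vector operator \<Rightarrow> 'h set" where
  "op_kernel T = {x. (x, 0) \<in> T}"

text \<open>The next two predicates are meant for linear subspaces; dimensions are over the complex
  numbers.\<close>

definition finite_dimensional :: "'h :: complex_normed_vector set \<Rightarrow> bool" where
  "finite_dimensional V \<longleftrightarrow> (\<exists>B. finite B \<and> V \<subseteq> complex_vector.span B)"

definition finite_codimensional :: "'h :: complex_normed_vector set \<Rightarrow> bool" where
  "finite_codimensional V \<longleftrightarrow>
    (\<exists>B. finite B \<and> (\<forall>x. \<exists>v\<in>V. x - v \<in> complex_vector.span B))"

definition fredholm :: "'h :: complex_normed_vector operator \<Rightarrow> bool" where
  "fredholm T \<longleftrightarrow>
    closed (Range T) \<and> finite_dimensional (op_kernel T) \<and> finite_codimensional (Range T)"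

text \<open>Meant for closed densely defined \<open>T\<close>; these properties are not part of the
  definition.\<close>

definition ess_spectrum :: "'h :: complex_normed_vector operator \<Rightarrow> complex set" where
  "ess_spectrum T = {\<mu>. \<not> fredholm (op_shift T \<mu>)}"

definition square_integrable :: "(real \<Rightarrow> complex) \<Rightarrow> bool" where
  "square_integrable f \<longleftrightarrow>
    f \<in> borel_measurable lborel \<and> integrable lborel (\<lambda>x. (cmod (f x))\<^sup>2)"

definition l2_rel :: "(real \<Rightarrow> complex) \<Rightarrow> (real \<Rightarrow> complex) \<Rightarrow> bool" where
  "l2_rel f g \<longleftrightarrow>
    square_integrable f \<and> square_integrable g \<and> (AE x in lborel. f x = g x)"

lemma square_integrable_zero: "square_integrable (\<lambda>x. 0)"
  by (simp add: square_integrable_def)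

lemma square_integrable_mult: "square_integrable f \<Longrightarrow> square_integrable (\<lambda>x. c * f x)"
  by (auto simp: square_integrable_def norm_mult power_mult_distrib)

lemma square_integrable_add:
  assumes "square_integrable f" "square_integrable g"
  shows "square_integrable (\<lambda>x. f x + g x)"
proof -
  have [measurable]: "f \<in> borel_measurable lborel" "g \<in> borel_measurable lborel"
    using assms by (auto simp: square_integrable_def)
  have "integrable lborel (\<lambda>x. (cmod (f x + g x))\<^sup>2)"
  proof (rule Bochner_Integration.integrable_bound)
    show "integrable lborel (\<lambda>x. 2 * (cmod (f x))\<^sup>2 + 2 * (cmod (g x))\<^sup>2)"
      using assms by (auto simp: square_integrable_def)
    have "(cmod (f x + g x))\<^sup>2 \<le> 2 * (cmod (f x))\<^sup>2 + 2 * (cmod (g x))\<^sup>2" for x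
    proof -
      have "(cmod (f x + g x))\<^sup>2 \<le> (cmod (f x) + cmod (g x))\<^sup>2"
        by (intro power_mono norm_triangle_ineq) simp
      also have "\<dots> \<le> 2 * (cmod (f x))\<^sup>2 + 2 * (cmod (g x))\<^sup>2"
        using sum_squares_bound[of "cmod (f x)" "cmod (g x)"]
        by (simp add: power2_sum)
      finally show ?thesis .
    qed
    then show "AE x in lborel. norm ((cmod (f x + g x))\<^sup>2)
        \<le> norm (2 * (cmod (f x))\<^sup>2 + 2 * (cmod (g x))\<^sup>2)"
      by (intro AE_I2) simp
  qed measurable
  then show ?thesis
    by (simp add: square_integrable_def)
qed

lemma integrable_inner_square_integrable:
  assumes "square_integrable f" "square_integrable g"
  shows "integrable lborel (\<lambda>x. f x \<bullet> g x)"
proof (rule Bochner_Integration.integrable_bound)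
  show "integrable lborel (\<lambda>x. (cmod (f x))\<^sup>2 + (cmod (g x))\<^sup>2)"
    using assms by (auto simp: square_integrable_def)
  have [measurable]: "f \<in> borel_measurable lborel" "g \<in> borel_measurable lborel"
    using assms by (auto simp: square_integrable_def)
  show "(\<lambda>x. f x \<bullet> g x) \<in> borel_measurable lborel"
    by measurable
  have "\<bar>f x \<bullet> g x\<bar> \<le> (cmod (f x))\<^sup>2 + (cmod (g x))\<^sup>2" for x
    using Cauchy_Schwarz_ineq2[of "f x" "g x"] sum_squares_bound[of "cmod (f x)" "cmod (g x)"]
      zero_le_power2[of "cmod (f x)"] zero_le_power2[of "cmod (g x)"]
      mult_nonneg_nonneg[OF norm_ge_zero[of "f x"] norm_ge_zero[of "g x"]]
    by linarith
  then show "AE x in lborel. norm (f x \<bullet> g x) \<le> norm ((cmod (f x))\<^sup>2 + (cmod (g x))\<^sup>2)"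
    by (intro AE_I2) simp
qed

quotient_type l2 = "real \<Rightarrow> complex" / partial: l2_rel
proof (rule part_equivpI)
  show "\<exists>f. l2_rel f f"
    using square_integrable_zero by (auto simp: l2_rel_def)
  show "symp l2_rel"
    by (auto simp: symp_def l2_rel_def elim: AE_mp)
  show "transp l2_rel"
    unfolding transp_def l2_rel_def by (auto elim!: eventually_elim2)
qed

text \<open>The real inner product on \<open>l2\<close> is the real part of
  \<open>\<integral> f (cnj g)\<close>, because \<open>z \<bullet> w = Re (z * cnj w)\<close> on \<^typ>\<open>complex\<close>; it
  induces the usual norm.\<close>

instantiation l2 :: real_inner
begin

lift_definition zero_l2 :: l2 is "\<lambda>x. 0"
  by (simp add: l2_rel_def square_integrable_zero)

lift_definition plus_l2 :: "l2 \<Rightarrow> l2 \<Rightarrow> l2" is "\<lambda>f g x. f x + g x"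
  unfolding l2_rel_def by (auto intro: square_integrable_add elim!: eventually_elim2)

lift_definition uminus_l2 :: "l2 \<Rightarrow> l2" is "\<lambda>f x. - f x"
  unfolding l2_rel_def using square_integrable_mult[of _ "-1"] by auto

definition minus_l2 :: "l2 \<Rightarrow> l2 \<Rightarrow> l2" where
  "minus_l2 f g = f + (- g)"

lift_definition scaleR_l2 :: "real \<Rightarrow> l2 \<Rightarrow> l2" is "\<lambda>r f x. complex_of_real r * f x"
  unfolding l2_rel_def using square_integrable_mult by auto

lift_definition inner_l2 :: "l2 \<Rightarrow> l2 \<Rightarrow> real" is "\<lambda>f g. \<integral>x. f x \<bullet> g x \<partial>lborel"
proof -
  fix f f' g g' assume "l2_rel f f'" "l2_rel g g'"
  then show "(\<integral>x. f x \<bullet> g x \<partial>lborel) = (\<integral>x. f' x \<bullet> g' x \<partial>lborel)"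
    unfolding l2_rel_def
    by (intro integral_cong_AE borel_measurable_integrable integrable_inner_square_integrable)
       (auto elim: eventually_elim2)
qed

definition norm_l2 :: "l2 \<Rightarrow> real" where
  "norm_l2 f = sqrt (f \<bullet> f)"

definition sgn_l2 :: "l2 \<Rightarrow> l2" where
  "sgn_l2 f = inverse (norm f) *\<^sub>R f"

definition dist_l2 :: "l2 \<Rightarrow> l2 \<Rightarrow> real" where
  "dist_l2 f g = norm (f - g)"

definition uniformity_l2 :: "(l2 \<times> l2) filter" where
  "uniformity_l2 = (INF e\<in>{0 <..}. principal {(x, y). dist x y < e})"

definition open_l2 :: "l2 set \<Rightarrow> bool" where
  "open_l2 U \<longleftrightarrow> (\<forall>x\<in>U. eventually (\<lambda>(x', y). x' = x \<longrightarrow> y \<in> U) uniformity)"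

instance
proof
  fix f g h :: l2 and r s :: real
  show "f + g + h = f + (g + h)"
    by transfer (auto simp: l2_rel_def add.assoc intro!: square_integrable_add)
  show "f + g = g + f"
    by transfer (auto simp: l2_rel_def add.commute intro!: square_integrable_add)
  show "0 + f = f"
    by transfer (auto simp: l2_rel_def)
  show "- f + f = 0"
    by transfer (auto simp: l2_rel_def square_integrable_zero)
  show "f - g = f + - g"
    by (rule minus_l2_def)
  show "r *\<^sub>R (f + g) = r *\<^sub>R f + r *\<^sub>R g"
    by transfer (auto simp: l2_rel_def distrib_left distrib_right
        intro!: square_integrable_add square_integrable_mult)
  show "(r + s) *\<^sub>R f = r *\<^sub>R f + s *\<^sub>R f"
    by transfer (auto simp: l2_rel_def distrib_left distrib_right
        intro!: square_integrable_add square_integrable_mult)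
  show "r *\<^sub>R s *\<^sub>R f = (r * s) *\<^sub>R f"
    by transfer (auto simp: l2_rel_def mult.assoc intro!: square_integrable_mult)
  show "1 *\<^sub>R f = f"
    by transfer (auto simp: l2_rel_def)
  show "dist f g = norm (f - g)" by (rule dist_l2_def)
  show "sgn f = inverse (norm f) *\<^sub>R f" by (rule sgn_l2_def)
  show "uniformity = (INF e\<in>{0 <..}. principal {(x, y :: l2). dist x y < e})"
    by (rule uniformity_l2_def)
  show "open U \<longleftrightarrow> (\<forall>x\<in>U. eventually (\<lambda>(x', y). x' = x \<longrightarrow> y \<in> U) uniformity)"
    for U :: "l2 set"
    by (rule open_l2_def)
  show "f \<bullet> g = g \<bullet> f"
    by transfer (simp add: inner_commute)
  show "(f + g) \<bullet> h = f \<bullet> h + g \<bullet> h"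
    by transfer (simp add: l2_rel_def inner_add_left integrable_inner_square_integrable)
  show "(r *\<^sub>R f) \<bullet> g = r * (f \<bullet> g)"
    by transfer (simp add: flip: scaleR_conv_of_real)
  show "0 \<le> f \<bullet> f"
    by transfer simp
  show "f \<bullet> f = 0 \<longleftrightarrow> f = 0"
  proof transfer
    fix f assume "l2_rel f f"
    then have f: "square_integrable f"
      by (simp add: l2_rel_def)
    have "(\<integral>x. f x \<bullet> f x \<partial>lborel) = 0 \<longleftrightarrow> (AE x in lborel. f x \<bullet> f x = 0)"
      by (rule integral_nonneg_eq_0_iff_AE)
         (auto intro: integrable_inner_square_integrable f)
    then show "(\<integral>x. f x \<bullet> f x \<partial>lborel) = 0 \<longleftrightarrow> l2_rel f (\<lambda>x. 0)"
      by (simp add: l2_rel_def f square_integrable_zero)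
  qed
  show "norm f = sqrt (f \<bullet> f)" by (rule norm_l2_def)
qed

end

instantiation l2 :: complex_normed_vector
begin

lift_definition scaleC_l2 :: "complex \<Rightarrow> l2 \<Rightarrow> l2" is "\<lambda>c f x. c * f x"
  unfolding l2_rel_def using square_integrable_mult by auto

instance
proof
  fix f g :: l2 and c c' :: complex and r :: real
  show "c *\<^sub>C (f + g) = c *\<^sub>C f + c *\<^sub>C g"
    by transfer (auto simp: l2_rel_def distrib_left distrib_right
        intro!: square_integrable_add square_integrable_mult)
  show "(c + c') *\<^sub>C f = c *\<^sub>C f + c' *\<^sub>C f"
    by transfer (auto simp: l2_rel_def distrib_left distrib_right
        intro!: square_integrable_add square_integrable_mult)
  show "c *\<^sub>C c' *\<^sub>C f = (c * c') *\<^sub>C f"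
    by transfer (auto simp: l2_rel_def mult.assoc intro!: square_integrable_mult)
  show "complex_of_real r *\<^sub>C f = r *\<^sub>R f"
    by transfer (auto simp: l2_rel_def intro!: square_integrable_mult)
  have "(c *\<^sub>C f) \<bullet> (c *\<^sub>C f) = (cmod c)\<^sup>2 * (f \<bullet> f)"
    by transfer (simp add: norm_mult power_mult_distrib flip: power2_norm_eq_inner)
  then show "norm (c *\<^sub>C f) = cmod c * norm f"
    by (simp add: norm_eq_sqrt_inner real_sqrt_mult)
qed

end


abbreviation vderiv :: "(real \<Rightarrow> complex) \<Rightarrow> real \<Rightarrow> complex" where
  "vderiv f \<equiv> \<lambda>x. vector_derivative f (at x)"

definition smooth :: "(real \<Rightarrow> complex) \<Rightarrow> bool" where
  "smooth f \<longleftrightarrow> (\<forall>j x. (vderiv ^^ j) f differentiable (at x))"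

definition test_function :: "(real \<Rightarrow> complex) \<Rightarrow> bool" where
  "test_function f \<longleftrightarrow> smooth f \<and> compact (closure {x. f x \<noteq> 0})"

definition D :: "(real \<Rightarrow> complex) \<Rightarrow> real \<Rightarrow> complex" where
  "D f = (\<lambda>x. - \<i> * vector_derivative f (at x))"

definition diff_op :: "nat \<Rightarrow> (nat \<Rightarrow> real \<Rightarrow> complex) \<Rightarrow> (real \<Rightarrow> complex) \<Rightarrow> real \<Rightarrow> complex" where
  "diff_op N p f = (\<lambda>x. \<Sum>j\<le>N. p j x * (D ^^ j) f x)"

text \<open>\<^const>\<open>abs_l2\<close> sends a square-integrable function to its class; with smooth
  coefficients it is applied here to smooth compactly supported functions only.\<close>

definition minimal_op :: "nat \<Rightarrow> nat \<Rightarrow> (nat \<Rightarrow> real \<Rightarrow> complex) \<Rightarrow> (nat \<Rightarrow> real \<Rightarrow> complex) \<Rightarrow>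
    (nat \<Rightarrow> real \<Rightarrow> complex) \<Rightarrow> (real \<Rightarrow> complex) \<Rightarrow> (l2 \<times> l2) operator" where
  "minimal_op n k a b c d =
    {((abs_l2 u, abs_l2 v),
      (abs_l2 (\<lambda>x. diff_op (n + k) a u x + diff_op n b v x),
       abs_l2 (\<lambda>x. diff_op k c u x + d x * v x))) | u v. test_function u \<and> test_function v}"

definition dn_symbol :: "nat \<Rightarrow> nat \<Rightarrow> (nat \<Rightarrow> real \<Rightarrow> complex) \<Rightarrow> (nat \<Rightarrow> real \<Rightarrow> complex) \<Rightarrow>
    (nat \<Rightarrow> real \<Rightarrow> complex) \<Rightarrow> (real \<Rightarrow> complex) \<Rightarrow> complex \<Rightarrow> real \<Rightarrow> real \<Rightarrow> complex^2^2" where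
  "dn_symbol n k a b c d z x \<xi> = vector
    [vector [a (n + k) x * of_real \<xi> ^ (n + k), b n x * of_real \<xi> ^ n],
     vector [c k x * of_real \<xi> ^ k,             d x - z]]"

definition dn_elliptic :: "nat \<Rightarrow> nat \<Rightarrow> (nat \<Rightarrow> real \<Rightarrow> complex) \<Rightarrow> (nat \<Rightarrow> real \<Rightarrow> complex) \<Rightarrow>
    (nat \<Rightarrow> real \<Rightarrow> complex) \<Rightarrow> (real \<Rightarrow> complex) \<Rightarrow> complex \<Rightarrow> bool" where
  "dn_elliptic n k a b c d z \<longleftrightarrow> (\<forall>x \<xi>. \<xi> \<noteq> 0 \<longrightarrow> det (dn_symbol n k a b c d z x \<xi>) \<noteq> 0)"

end

theory Submission
  imports Defs
begin

text \<open>Write $m = n + k$. Non-ellipticity at \<open>z\<close> means that the continuous function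
\<open>d - z - b\<^sub>n c\<^sub>k / a\<^sub>m\<close>, the reduced symbol of the shifted operator matrix, vanishes at some
point \<open>x\<^sub>0\<close> (\<open>dn_elliptic_iff\<close>). Close to \<open>x\<^sub>0\<close> the reduced symbol is then small, and the proof
turns this into test-function pairs on which the shifted operator is small.

Given a bump \<open>\<phi>\<close> supported near \<open>x\<^sub>0\<close>, put \<open>v(x) = e\<^sup>i\<^sup>\<xi>\<^sup>x \<phi>(x)\<close> with a large frequency \<open>\<xi>\<close> and look
for \<open>u\<close> as a finite WKB sum of terms \<open>\<xi>\<^sup>q e\<^sup>i\<^sup>\<xi>\<^sup>x w\<^sub>q(x)\<close> with \<open>q \<le> -k\<close>. As \<open>a\<^sub>m\<close> has no zeros,
the coefficients \<open>w\<^sub>q\<close> can be chosen one after the other, by pointwise division by \<open>a\<^sub>m\<close>, so that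
every nonnegative power of \<open>\<xi>\<close> cancels in the first component of the image
(\<open>wkb_null_solution\<close>). The leading coefficient of \<open>u\<close> is \<open>-b\<^sub>n \<phi> / a\<^sub>m\<close>, so in the second
component only the reduced symbol times \<open>e\<^sup>i\<^sup>\<xi>\<^sup>x \<phi>\<close> survives as \<open>\<xi> \<rightarrow> \<infinity>\<close>
(\<open>localized_approximate_null_pair\<close>). All \<open>w\<^sub>q\<close> live where \<open>\<phi>\<close> does, so bumps on disjoint
intervals accumulating at \<open>x\<^sub>0\<close> give arbitrarily many mutually orthogonal pairs, with norm at
least one, and images of norm at most \<open>\<epsilon>\<close>.

Such families cannot exist for a closed Fredholm operator. By the open mapping theorem, closed
range yields a constant \<open>C\<close> such that each \<open>g\<close> in the range has a preimage of norm at most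
\<open>C \<parallel>g\<parallel>\<close>; hence each pair lies within distance \<open>C \<epsilon>\<close> of the kernel. If the kernel has
dimension at most \<open>N\<close> and \<open>\<epsilon>\<close> is small, then \<open>N + 1\<close> of these pairs have linearly independent
approximants in the kernel, a contradiction (\<open>not_fredholm_if_singular_families\<close>). The open mapping theorem
needs the completeness of the space of square integrable functions.

Operators are treated as graphs throughout, so the open mapping theorem is proved for closed
linear relations.\<close>

section \<open>Bounded preimages and a criterion for failing to be Fredholm\<close>

text \<open>The first half of the open mapping theorem, for a linear relation. The closures of the images of
the balls of radius $n$ cover the complete space \<^term>\<open>Range T\<close>, so by Baire one of them
contains a ball of \<^term>\<open>Range T\<close>. Differences of points in that ball, rescaled, approximate any
\<open>g\<close> with a relative error of one half.\<close>

lemma closed_relation_approximate_preimages: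
  fixes T :: "('a::banach \<times> 'b::banach) set"
  assumes T: "subspace T" and R: "closed (Range T)"
  shows "\<exists>C. \<forall>g\<in>Range T. \<exists>f h. (f, h) \<in> T \<and> norm f \<le> C * norm g \<and> norm (g - h) \<le> norm g / 2"
proof -
  define A where "A n = closure (snd ` {p\<in>T. norm (fst p) \<le> real n})" for n :: nat
  have subR: "A n \<subseteq> Range T" for n
    unfolding A_def by (rule closure_minimal) (use R in auto)
  have cover: "Range T \<subseteq> \<Union> (range A)"
  proof
    fix g assume "g \<in> Range T"
    then obtain f where f: "(f, g) \<in> T" by auto
    obtain n where "norm f \<le> real n" using real_arch_simple by blast
    then have "g \<in> snd ` {p\<in>T. norm (fst p) \<le> real n}" using f by force
    then have "g \<in> A n" unfolding A_def by (rule subsetD[OF closure_subset])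
    then show "g \<in> \<Union> (range A)" by blast
  qed
  let ?X = "top_of_set (Range T)"
  have clX: "closedin ?X (A n)" for n by (rule closed_subset[OF subR]) (simp add: A_def)
  have ne: "(0, 0) \<in> T" using subspace_0[OF T] by (simp add: zero_prod_def)
  have "\<exists>n. ?X interior_of (A n) \<noteq> {}"
  proof (rule ccontr)
    assume "\<not> ?thesis"
    then have "?X interior_of \<Union> (range A) = {}"
      by (intro Baire_category_alt)
        (auto simp: R clX completely_metrizable_space_closedin completely_metrizable_space_euclidean intro!: disjI1)
    moreover have "\<Union> (range A) = Range T" using cover subR by blast
    ultimately have "Range T = {}" using interior_of_topspace[of ?X] by simp
    then show False using ne by auto
  qed
  then obtain n g0 where g0: "g0 \<in> ?X interior_of (A n)" by blast
  then obtain U where U: "openin ?X U" "g0 \<in> U" "U \<subseteq> A n" by (auto simp: interior_of_def)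
  then obtain r where r: "r > 0" "ball g0 r \<inter> Range T \<subseteq> A n" and g0R: "g0 \<in> Range T"
    unfolding openin_contains_ball by blast
  show ?thesis
  proof (intro exI[of _ "4 * real n / r"] ballI)
    fix g assume g: "g \<in> Range T"
    show "\<exists>f h. (f, h) \<in> T \<and> norm f \<le> 4 * real n / r * norm g \<and> norm (g - h) \<le> norm g / 2"
    proof (cases "g = 0")
      case True
      then show ?thesis using ne by (intro exI[of _ 0]) auto
    next
      case False
      define s where "s = r / (2 * norm g)"
      have s: "s > 0" "s * norm g = r / 2" using r False by (auto simp: s_def)
      \<comment> \<open>The step \<open>s\<close> keeps \<open>g1\<close> inside the ball of radius \<open>r\<close>; approximating both ends up to
        \<open>r / 8\<close> leaves, after division by \<open>s\<close>, an error of at most half the norm of \<open>g\<close>.\<close>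
      define g1 where "g1 = g0 + s *\<^sub>R g"
      have "g1 \<in> Range T"
      proof -
        obtain f0 f where "(f0, g0) \<in> T" "(f, g) \<in> T" using g0R g by auto
        then have "(f0, g0) + s *\<^sub>R (f, g) \<in> T" by (intro subspace_add subspace_scale T)
        then show ?thesis by (auto simp: g1_def)
      qed
      moreover have "g1 \<in> ball g0 r" using s r by (simp add: g1_def dist_norm)
      ultimately have g1: "g1 \<in> A n" using r by blast
      have g0A: "g0 \<in> A n" using g0R r by auto
      have ap: "\<exists>f h. (f, h) \<in> T \<and> norm f \<le> real n \<and> norm (h - y) < r / 8" if "y \<in> A n" for y
      proof -
        have "\<exists>h\<in>snd ` {p\<in>T. norm (fst p) \<le> real n}. dist h y < r / 8"
          using that r(1) unfolding A_def closure_approachable by (meson divide_pos_pos zero_less_numeral)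
        then show ?thesis by (force simp: dist_norm)
      qed
      obtain f0 h0 where 0: "(f0, h0) \<in> T" "norm f0 \<le> real n" "norm (h0 - g0) < r / 8" using ap[OF g0A] by auto
      obtain f1 h1 where 1: "(f1, h1) \<in> T" "norm f1 \<le> real n" "norm (h1 - g1) < r / 8" using ap[OF g1] by auto
      define f h where "f = (1/s) *\<^sub>R (f1 - f0)" and "h = (1/s) *\<^sub>R (h1 - h0)"
      have "(1/s) *\<^sub>R ((f1, h1) - (f0, h0)) \<in> T"
        by (intro subspace_scale subspace_diff T 0 1)
      then have fh: "(f, h) \<in> T" by (simp add: f_def h_def)
      have "norm f \<le> (1/s) * (real n + real n)"
        unfolding f_def norm_scaleR using s 0 1 norm_triangle_ineq4[of f1 f0]
        by (auto intro!: mult_left_mono simp del: times_divide_eq_left)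
      also have "\<dots> = 4 * real n / r * norm g" using r False by (simp add: s_def field_simps)
      finally have nf: "norm f \<le> 4 * real n / r * norm g" .
      have "h - g = (1/s) *\<^sub>R ((h1 - g1) - (h0 - g0))"
        using s by (simp add: h_def g1_def algebra_simps)
      then have "norm (g - h) = (1/s) * norm ((h1 - g1) - (h0 - g0))"
        using s by (metis norm_minus_commute norm_scaleR abs_of_pos zero_less_divide_1_iff)
      also have "\<dots> \<le> (1/s) * (r/8 + r/8)"
        using s 0 1 norm_triangle_ineq4[of "h1 - g1" "h0 - g0"] by (intro mult_left_mono) auto
      also have "\<dots> = norm g / 2" using r False by (simp add: s_def field_simps)
      finally show ?thesis using fh nf by blast
    qed
  qed
qed

text \<open>The second half of the open mapping theorem: repeated correction of the remaining error halves it
each time, so the corrections form an absolutely convergent series. Closedness of the graph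
identifies its sum as an exact preimage.\<close>

lemma closed_relation_bounded_preimages:
  fixes T :: "('a::banach \<times> 'b::banach) set"
  assumes T: "subspace T" and cl: "closed T" and R: "closed (Range T)"
  shows "\<exists>C. \<forall>g\<in>Range T. \<exists>f. (f, g) \<in> T \<and> norm f \<le> C * norm g"
proof -
  obtain C where C: "\<forall>g\<in>Range T. \<exists>f h. (f, h) \<in> T \<and> norm f \<le> C * norm g \<and> norm (g - h) \<le> norm g / 2"
    using closed_relation_approximate_preimages[OF T R] by blast
  then obtain F H where FH: "\<And>g. g \<in> Range T \<Longrightarrow> (F g, H g) \<in> T"
    "\<And>g. g \<in> Range T \<Longrightarrow> norm (F g) \<le> C * norm g" "\<And>g. g \<in> Range T \<Longrightarrow> norm (g - H g) \<le> norm g / 2"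
    by metis
  have "\<exists>f. (f, g) \<in> T \<and> norm f \<le> 2 * max C 0 * norm g" if g: "g \<in> Range T" for g
  proof -
    define e where "e i = ((\<lambda>y. y - H y) ^^ i) g" for i
    have e: "e i \<in> Range T \<and> norm (e i) \<le> norm g * (1/2) ^ i" for i
    proof (induction i)
      case 0
      then show ?case using g by (simp add: e_def)
    next
      case (Suc i)
      then obtain f where "(f, e i) \<in> T" by auto
      then have "(f, e i) - (F (e i), H (e i)) \<in> T"
        using FH(1)[OF conjunct1[OF Suc]] by (intro subspace_diff T)
      moreover have "e (Suc i) = e i - H (e i)" by (simp add: e_def)
      ultimately show ?case using Suc FH(3)[of "e i"] by auto
    qed
    have step: "e (Suc i) = e i - H (e i)" for i by (simp add: e_def)
    have bound: "norm (F (e i)) \<le> max C 0 * norm g * (1/2) ^ i" for i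
    proof -
      have "norm (F (e i)) \<le> max C 0 * norm (e i)"
        using FH(2)[of "e i"] e[of i] mult_right_mono[of C "max C 0" "norm (e i)"] by auto
      also have "\<dots> \<le> max C 0 * (norm g * (1/2) ^ i)" using e[of i] by (intro mult_left_mono) auto
      finally show ?thesis by (simp add: mult.assoc)
    qed
    have geo: "(\<lambda>i. max C 0 * norm g * (1/2) ^ i) sums (max C 0 * norm g * 2)"
      using geometric_sums[of "1/2::real"] by (intro sums_mult) auto
    have sumn: "summable (\<lambda>i. norm (F (e i)))"
      by (rule summable_comparison_test[OF _ sums_summable[OF geo]]) (use bound in auto)
    then have sumF: "(\<lambda>N. \<Sum>i<N. F (e i)) \<longlonglongrightarrow> (\<Sum>i. F (e i))"
      by (rule summable_LIMSEQ[OF summable_norm_cancel])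
    have "norm (\<Sum>i. F (e i)) \<le> (\<Sum>i. norm (F (e i)))" by (rule summable_norm[OF sumn])
    also have "\<dots> \<le> max C 0 * norm g * 2"
      using suminf_le[OF bound sumn sums_summable[OF geo]] geo by (simp add: sums_iff)
    finally have nf: "norm (\<Sum>i. F (e i)) \<le> 2 * max C 0 * norm g" by (simp add: mult_ac)
    have part: "(\<Sum>i<N. F (e i), g - e N) \<in> T" for N
    proof (induction N)
      case 0
      then show ?case using subspace_0[OF T] by (simp add: e_def zero_prod_def)
    next
      case (Suc N)
      then have "(\<Sum>i<N. F (e i), g - e N) + (F (e N), H (e N)) \<in> T"
        using FH(1)[OF conjunct1[OF e[of N]]] by (intro subspace_add T)
      then show ?case by (simp add: step algebra_simps)
    qed
    have "(\<lambda>i. norm g * (1/2) ^ i) \<longlonglongrightarrow> norm g * 0"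
      by (rule tendsto_mult[OF tendsto_const LIMSEQ_power_zero]) simp
    then have "(\<lambda>i. norm g * (1/2) ^ i) \<longlonglongrightarrow> 0"
      by simp
    then have "e \<longlonglongrightarrow> 0"
      by (rule Lim_null_comparison[OF always_eventually[OF allI[OF conjunct2[OF e]]]])
    then have "(\<lambda>N. (\<Sum>i<N. F (e i), g - e N)) \<longlonglongrightarrow> (\<Sum>i. F (e i), g - 0)"
      by (intro tendsto_Pair sumF tendsto_diff tendsto_const)
    then have "(\<Sum>i. F (e i), g - 0) \<in> T"
      by (rule closed_sequentially[OF cl part])
    then have "(\<Sum>i. F (e i), g) \<in> T"
      by simp
    then show ?thesis using nf by blast
  qed
  then show ?thesis by blast
qed

text \<open>The vectors are indexed and may repeat, in which case a difference of two equal ones is the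
required relation.\<close>

lemma linear_dependence_of_many:
  fixes h :: "nat \<Rightarrow> 'h::complex_normed_vector"
  assumes B: "finite B" and h: "\<And>i. i \<le> card B \<Longrightarrow> h i \<in> complex_vector.span B"
  shows "\<exists>c. (\<exists>i\<le>card B. c i \<noteq> 0) \<and> (\<Sum>i\<le>card B. c i *\<^sub>C h i) = 0"
proof (cases "inj_on h {..card B}")
  case True
  have "complex_vector.dependent (h ` {..card B})"
  proof (rule ccontr)
    assume "\<not> ?thesis"
    then have "card (h ` {..card B}) \<le> card B"
      using complex_vector.independent_span_bound[OF B] h by blast
    then show False using card_image[OF True] by simp
  qed
  then obtain u v where u: "v \<in> h ` {..card B}" "u v \<noteq> 0" "(\<Sum>v\<in>h ` {..card B}. u v *\<^sub>C v) = 0"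
    by (auto simp: complex_vector.dependent_finite)
  then have "(\<Sum>i\<le>card B. u (h i) *\<^sub>C h i) = 0"
    by (simp add: sum.reindex[OF True])
  then show ?thesis using u by (intro exI[of _ "\<lambda>i. u (h i)"]) auto
next
  case False
  then obtain i j where ij: "i \<le> card B" "j \<le> card B" "i \<noteq> j" "h i = h j"
    by (auto simp: inj_on_def)
  define c :: "nat \<Rightarrow> complex" where "c l = (if l = i then 1 else if l = j then -1 else 0)" for l
  have "(\<Sum>l\<le>card B. c l *\<^sub>C h l) = (\<Sum>l\<in>{i, j}. c l *\<^sub>C h l)"
    by (rule sum.mono_neutral_right) (use ij in \<open>auto simp: c_def\<close>)
  also have "\<dots> = 1 *\<^sub>C h j + (-1) *\<^sub>C h j" using ij by (simp add: c_def)
  also have "\<dots> = 0" by (simp only: scaleC_add_left[symmetric]) simp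
  finally show ?thesis using ij by (intro exI[of _ c]) (auto simp: c_def)
qed

text \<open>The lower bound on linear
combinations is a uniform form of linear independence; it says that the $f_j$ behave like an
orthogonal family of vectors of norm at least one. Subtracting from each $f_j$ a small preimage
of $g_j$ puts it into the kernel; a linear relation between the resulting kernel elements
would give a combination of the $f_j$ that is too short for its largest coefficient.\<close>

lemma not_fredholm_if_singular_families:
  fixes T :: "('h::{complex_normed_vector, banach}) operator"
  assumes T: "subspace T" and cl: "closed T"
    and sing: "\<And>N \<epsilon>. \<epsilon> > 0 \<Longrightarrow> \<exists>f g. (\<forall>i\<le>N. (f i, g i) \<in> T \<and> norm (g i) \<le> \<epsilon>) \<and>
      (\<forall>c. \<forall>i\<le>N. cmod (c i) \<le> norm (\<Sum>j\<le>(N::nat). c j *\<^sub>C f j))"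
  shows "\<not> fredholm T"
proof
  assume F: "fredholm T"
  then obtain B where B: "finite B" "op_kernel T \<subseteq> complex_vector.span B"
    by (auto simp: fredholm_def finite_dimensional_def)
  obtain C where C: "\<forall>g\<in>Range T. \<exists>f. (f, g) \<in> T \<and> norm f \<le> C * norm g"
    using closed_relation_bounded_preimages[OF T cl] F by (auto simp: fredholm_def)
  define N where "N = card B"
  define K where "K = max C 1"
  \<comment> \<open>Small enough that $N + 1$ preimages of norm at most $K \epsilon$, with coefficients of modulus at
    most $M$, sum up to at most $M / 2$.\<close>
  define \<epsilon> where "\<epsilon> = 1 / (2 * K * (real N + 1))"
  have K: "K \<ge> 1" "K \<ge> C" by (auto simp: K_def)
  have eps: "\<epsilon> > 0" using K by (auto simp: \<epsilon>_def)
  obtain f g where fg: "\<And>i. i \<le> N \<Longrightarrow> (f i, g i) \<in> T" "\<And>i. i \<le> N \<Longrightarrow> norm (g i) \<le> \<epsilon>"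
    and lower: "\<And>c i. i \<le> N \<Longrightarrow> cmod (c i) \<le> norm (\<Sum>j\<le>N. c j *\<^sub>C f j)"
    using sing[OF eps, of N] by blast
  have "\<forall>i\<in>{..N}. \<exists>e. (e, g i) \<in> T \<and> norm e \<le> K * \<epsilon>"
  proof
    fix i assume i: "i \<in> {..N}"
    then obtain e where e: "(e, g i) \<in> T" "norm e \<le> C * norm (g i)" using C fg by blast
    note e(2)
    also have "C * norm (g i) \<le> K * \<epsilon>" using K fg(2)[of i] i by (intro mult_mono) auto
    finally show "\<exists>e. (e, g i) \<in> T \<and> norm e \<le> K * \<epsilon>" using e by auto
  qed
  then obtain e where e: "\<And>i. i \<le> N \<Longrightarrow> (e i, g i) \<in> T" "\<And>i. i \<le> N \<Longrightarrow> norm (e i) \<le> K * \<epsilon>"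
    by (metis atMost_iff)
  have ker: "f i - e i \<in> complex_vector.span B" if "i \<le> N" for i
  proof -
    have "(f i, g i) - (e i, g i) \<in> T" using that fg e by (intro subspace_diff T)
    then show ?thesis using B by (auto simp: op_kernel_def)
  qed
  obtain c where c: "\<exists>i\<le>N. c i \<noteq> 0" "(\<Sum>i\<le>N. c i *\<^sub>C (f i - e i)) = 0"
    using linear_dependence_of_many[OF B(1), of "\<lambda>i. f i - e i"] ker unfolding N_def by auto
  have "(\<Sum>i\<le>N. c i *\<^sub>C f i) - (\<Sum>i\<le>N. c i *\<^sub>C e i) = 0"
    using c(2) by (simp add: complex_vector.scale_right_diff_distrib sum_subtractf)
  then have eq: "(\<Sum>i\<le>N. c i *\<^sub>C f i) = (\<Sum>i\<le>N. c i *\<^sub>C e i)" by simp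
  define M where "M = Max ((\<lambda>i. cmod (c i)) ` {..N})"
  have M: "cmod (c i) \<le> M" if "i \<le> N" for i unfolding M_def using that by (intro Max_ge) auto
  have "M \<in> (\<lambda>i. cmod (c i)) ` {..N}" unfolding M_def by (intro Max_in) auto
  then obtain l where l: "l \<le> N" "cmod (c l) = M" by auto
  have Mpos: "M > 0" using c(1) M by (meson less_le_trans zero_less_norm_iff)
  have "M \<le> norm (\<Sum>i\<le>N. c i *\<^sub>C e i)" using lower[OF l(1), of c] l eq by simp
  also have "\<dots> \<le> (\<Sum>i\<le>N. norm (c i *\<^sub>C e i))" by (rule norm_sum)
  also have "\<dots> \<le> (\<Sum>i\<le>N. M * (K * \<epsilon>))"
    by (intro sum_mono) (use M e Mpos in \<open>auto simp: norm_scaleC intro!: mult_mono\<close>)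
  also have "\<dots> = M * (K * \<epsilon> * (real N + 1))" by simp
  also have "K * \<epsilon> * (real N + 1) = 1 / 2"
    using K by (simp add: \<epsilon>_def divide_simps)
  finally show False using Mpos by simp
qed

section \<open>Closures and shifts of graphs\<close>

lemma scaleR_eq_scaleC: "r *\<^sub>R (x :: 'a :: complex_normed_vector) = complex_of_real r *\<^sub>C x"
  by (simp add: scaleC_of_real)

lemma bounded_linear_scaleC: "bounded_linear (\<lambda>x. z *\<^sub>C (x :: 'a :: complex_normed_vector))"
proof (rule bounded_linear_intro)
  show "z *\<^sub>C (x + y) = z *\<^sub>C x + z *\<^sub>C y" for x y :: 'a by (rule scaleC_add_right)
  show "z *\<^sub>C (r *\<^sub>R x) = r *\<^sub>R z *\<^sub>C x" for r and x :: 'a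
    by (simp only: scaleR_eq_scaleC scaleC_scaleC mult.commute)
  show "norm (z *\<^sub>C x) \<le> norm x * cmod z" for x :: 'a by (simp add: norm_scaleC)
qed

lemma closure_subspace_real:
  fixes S :: "'a::real_normed_vector set"
  assumes S: "subspace S"
  shows "subspace (closure S)"
  unfolding subspace_def
proof (intro conjI ballI allI)
  show "0 \<in> closure S" using subspace_0[OF S] closure_subset by blast
next
  fix x y assume "x \<in> closure S" "y \<in> closure S"
  then obtain f g where "\<And>n. f n \<in> S" "f \<longlonglongrightarrow> x" "\<And>n. g n \<in> S" "g \<longlonglongrightarrow> y"
    unfolding closure_sequential by blast
  then show "x + y \<in> closure S"
    unfolding closure_sequential
    by (intro exI[of _ "\<lambda>n. f n + g n"]) (auto intro: subspace_add[OF S] tendsto_add)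
next
  fix c x assume "x \<in> closure S"
  then obtain f where "\<And>n. f n \<in> S" "f \<longlonglongrightarrow> x"
    unfolding closure_sequential by blast
  then show "c *\<^sub>R x \<in> closure S"
    unfolding closure_sequential
    by (intro exI[of _ "\<lambda>n. c *\<^sub>R f n"]) (auto intro: subspace_scale[OF S] tendsto_scaleR)
qed

lemma op_shift_iff: "(x, y) \<in> op_shift T z \<longleftrightarrow> (x, y + z *\<^sub>C x) \<in> T"
  by (auto simp: op_shift_def) (metis add_diff_cancel_right')

text \<open>Shifting an operator applies a continuous linear shear to its graph, so the shift inherits
closedness and linearity.\<close>

lemma op_shift_eq_vimage:
  "op_shift T z = (\<lambda>p. (fst p, snd p + z *\<^sub>C fst p)) -` T"
  by (auto simp: op_shift_iff)

lemma bounded_linear_shear: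
  "bounded_linear (\<lambda>p :: 'h \<times> 'h :: complex_normed_vector. (fst p, snd p + z *\<^sub>C fst p))"
  by (intro bounded_linear_Pair bounded_linear_add bounded_linear_fst bounded_linear_snd
      bounded_linear_compose[OF bounded_linear_scaleC])

lemma subspace_op_shift: "subspace T \<Longrightarrow> subspace (op_shift T z)"
  unfolding op_shift_eq_vimage
  by (rule linear_subspace_vimage[OF bounded_linear.linear[OF bounded_linear_shear]])

lemma closed_op_shift: "closed T \<Longrightarrow> closed (op_shift T z)"
  unfolding op_shift_eq_vimage
  by (rule continuous_closed_vimage[OF _ linear_continuous_at[OF bounded_linear_shear]])

section \<open>The Hilbert space of square integrable functions\<close>

lemma l2_rel_refl: "l2_rel f f \<longleftrightarrow> square_integrable f"
  by (simp add: l2_rel_def)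

lemma abs_l2_add:
  "square_integrable f \<Longrightarrow> square_integrable g \<Longrightarrow> abs_l2 f + abs_l2 g = abs_l2 (\<lambda>x. f x + g x)"
  by (simp add: plus_l2.abs_eq l2_rel_refl)

lemma abs_l2_scaleC: "square_integrable f \<Longrightarrow> c *\<^sub>C abs_l2 f = abs_l2 (\<lambda>x. c * f x)"
  by (simp add: scaleC_l2.abs_eq l2_rel_refl)

lemma abs_l2_minus:
  assumes "square_integrable f" "square_integrable g"
  shows "abs_l2 f - abs_l2 g = abs_l2 (\<lambda>x. f x - g x)"
proof -
  have "abs_l2 f - abs_l2 g = abs_l2 f + (-1) *\<^sub>C abs_l2 g"
    using scaleC_of_real[of "-1" "abs_l2 g"] by simp
  also have "\<dots> = abs_l2 (\<lambda>x. f x + (-1) * g x)"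
    unfolding abs_l2_scaleC[OF assms(2)] by (intro abs_l2_add assms square_integrable_mult)
  finally show ?thesis by simp
qed

lemma square_integrable_minus:
  "square_integrable f \<Longrightarrow> square_integrable g \<Longrightarrow> square_integrable (\<lambda>x. f x - g x)"
  using square_integrable_add[of f "\<lambda>x. (-1) * g x"] square_integrable_mult[of g "-1"] by simp

lemma inner_abs_l2:
  "square_integrable f \<Longrightarrow> square_integrable g \<Longrightarrow> abs_l2 f \<bullet> abs_l2 g = (\<integral>x. f x \<bullet> g x \<partial>lborel)"
  by (simp add: inner_l2.abs_eq l2_rel_refl)

lemma norm_abs_l2:
  "square_integrable f \<Longrightarrow> norm (abs_l2 f) = sqrt (\<integral>x. (cmod (f x))\<^sup>2 \<partial>lborel)"
  unfolding norm_eq_sqrt_inner[of "abs_l2 f"] by (simp add: inner_abs_l2 power2_norm_eq_inner)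

lemma nn_integral_eq_norm_abs_l2:
  assumes "square_integrable f"
  shows "(\<integral>\<^sup>+x. ennreal ((cmod (f x))\<^sup>2) \<partial>lborel) = ennreal ((norm (abs_l2 f))\<^sup>2)"
  using assms by (subst nn_integral_eq_integral) (auto simp: square_integrable_def norm_abs_l2)

lemma inner_abs_l2_disjoint:
  assumes "square_integrable f" "square_integrable g" "\<And>x. f x = 0 \<or> g x = 0"
  shows "abs_l2 f \<bullet> abs_l2 g = 0"
proof -
  have "f x \<bullet> g x = 0" for x using assms(3)[of x] by auto
  then show ?thesis by (simp add: inner_abs_l2 assms)
qed

lemma norm_abs_l2_le:
  assumes f: "square_integrable f" and g: "square_integrable g" and "\<epsilon> \<ge> 0"
    and le: "\<And>x. cmod (f x) \<le> \<epsilon> * cmod (g x)"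
  shows "norm (abs_l2 f) \<le> \<epsilon> * norm (abs_l2 g)"
proof -
  have "(\<integral>x. (cmod (f x))\<^sup>2 \<partial>lborel) \<le> (\<integral>x. \<epsilon>\<^sup>2 * (cmod (g x))\<^sup>2 \<partial>lborel)"
  proof (rule integral_mono)
    fix x
    have "(cmod (f x))\<^sup>2 \<le> (\<epsilon> * cmod (g x))\<^sup>2" by (intro power_mono le) simp
    then show "(cmod (f x))\<^sup>2 \<le> \<epsilon>\<^sup>2 * (cmod (g x))\<^sup>2" by (simp add: power_mult_distrib)
  qed (use f g in \<open>auto simp: square_integrable_def\<close>)
  then have "sqrt (\<integral>x. (cmod (f x))\<^sup>2 \<partial>lborel) \<le> sqrt (\<epsilon>\<^sup>2 * (\<integral>x. (cmod (g x))\<^sup>2 \<partial>lborel))" by simp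
  then show ?thesis using \<open>\<epsilon> \<ge> 0\<close> by (simp add: norm_abs_l2 f g real_sqrt_mult)
qed

lemma square_integrable_rep_l2: "square_integrable (rep_l2 X)"
  using Quotient_rep_reflp[OF Quotient_l2] by (simp add: l2_rel_refl)

lemma abs_rep_l2: "abs_l2 (rep_l2 X) = X"
  by (rule Quotient_abs_rep[OF Quotient_l2])

text \<open>A subsequence converging at a prescribed rate; for a geometric rate, pointwise convergence almost
everywhere follows.\<close>

lemma Cauchy_fast_subseq:
  fixes X :: "nat \<Rightarrow> 'a::metric_space"
  assumes "Cauchy X" and \<epsilon>: "\<And>k::nat. \<epsilon> k > (0::real)"
  obtains r where "strict_mono r" "\<And>k m n. m \<ge> k \<Longrightarrow> n \<ge> k \<Longrightarrow> dist (X (r m)) (X (r n)) < \<epsilon> k"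
proof -
  have "\<forall>k. \<exists>N. \<forall>m\<ge>N. \<forall>n\<ge>N. dist (X m) (X n) < \<epsilon> k"
    using assms unfolding Cauchy_def by blast
  then obtain K :: "nat \<Rightarrow> nat" where K: "\<And>k m n. m \<ge> K k \<Longrightarrow> n \<ge> K k \<Longrightarrow> dist (X m) (X n) < \<epsilon> k" by metis
  define r where "r k = k + (\<Sum>i\<le>k. K i)" for k :: nat
  have "strict_mono r" by (rule strict_monoI_Suc) (simp add: r_def)
  moreover have "K k \<le> r m" if "k \<le> m" for k m
  proof -
    have "K k \<le> (\<Sum>i\<le>m. K i)" using that by (intro member_le_sum) auto
    then show ?thesis by (simp add: r_def)
  qed
  ultimately show ?thesis using K by (intro that) auto
qed

text \<open>A finite weighted sum bounds the increments by a multiple of $2^{-n}$, so they are summable. The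
weight is what turns square summability, which alone would not suffice, into convergence.\<close>

lemma converges_if_weighted_square_summable:
  fixes s :: "nat \<Rightarrow> complex"
  assumes "(\<Sum>n. ennreal (4 ^ n * (cmod (s (Suc n) - s n))\<^sup>2)) \<noteq> \<infinity>"
  shows "convergent s"
proof -
  define q where "q n = ennreal (4 ^ n * (cmod (s (Suc n) - s n))\<^sup>2)" for n
  have "suminf q \<noteq> \<infinity>" using assms unfolding q_def .
  then obtain C where C: "C \<ge> 0" "suminf q = ennreal C"
    by (cases "suminf q") simp_all
  have "\<forall>n\<ge>0. cmod (s (Suc n) - s n) \<le> sqrt C * (1/2) ^ n"
  proof (intro allI impI)
    fix n :: nat
    have "q n \<le> ennreal C"
      using sum_le_suminf[OF summableI, of "{n}" q] by (simp add: C)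
    then have "4 ^ n * (cmod (s (Suc n) - s n))\<^sup>2 \<le> C"
      unfolding q_def using C(1) by simp
    moreover have "(2 ^ n * cmod (s (Suc n) - s n))\<^sup>2 = 4 ^ n * (cmod (s (Suc n) - s n))\<^sup>2"
      by (simp add: power2_eq_square mult_ac power_mult_distrib[symmetric])
    ultimately have "(2 ^ n * cmod (s (Suc n) - s n))\<^sup>2 \<le> C" by simp
    then have "2 ^ n * cmod (s (Suc n) - s n) \<le> sqrt C" by (rule real_le_rsqrt)
    then show "cmod (s (Suc n) - s n) \<le> sqrt C * (1/2) ^ n" by (simp add: field_simps)
  qed
  moreover have "summable (\<lambda>n. sqrt C * (1/2) ^ n)"
    by (intro summable_mult summable_geometric) simp
  ultimately have "summable (\<lambda>n. s (Suc n) - s n)"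
    by (rule summable_comparison_test[OF exI])
  then obtain l where "(\<lambda>N. \<Sum>n<N. s (Suc n) - s n) \<longlonglongrightarrow> l"
    using summable_LIMSEQ by blast
  then have "(\<lambda>N. s N - s 0) \<longlonglongrightarrow> l" by (simp add: sum_lessThan_telescope)
  then have "(\<lambda>N. (s N - s 0) + s 0) \<longlonglongrightarrow> l + s 0" by (intro tendsto_add tendsto_const)
  then show ?thesis by (auto simp: convergent_def)
qed

text \<open>The Riesz--Fischer theorem. A geometrically fast subsequence converges almost everywhere because
its weighted squared increments have finite total integral, and Fatou's lemma transfers the Cauchy
estimate to the pointwise limit.\<close>

instance l2 :: banach
proof
  fix X :: "nat \<Rightarrow> l2" assume X: "Cauchy X"
  obtain r where r: "strict_mono r"
    and fast: "\<And>k m n. m \<ge> k \<Longrightarrow> n \<ge> k \<Longrightarrow> dist (X (r m)) (X (r n)) < (1/4) ^ k"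
    using Cauchy_fast_subseq[OF X, of "\<lambda>k. (1/4) ^ k"] by auto
  define f where "f n = rep_l2 (X (r n))" for n
  have f: "square_integrable (f n)" for n by (simp add: f_def square_integrable_rep_l2)
  then have [measurable]: "f n \<in> borel_measurable lborel" for n by (simp add: square_integrable_def)
  have nn: "(\<integral>\<^sup>+x. ennreal ((cmod (f m x - f n x))\<^sup>2) \<partial>lborel) = ennreal ((dist (X (r m)) (X (r n)))\<^sup>2)" for m n
    using nn_integral_eq_norm_abs_l2[OF square_integrable_minus[OF f f], of m n]
      abs_l2_minus[OF f f, of m n, symmetric] by (simp add: dist_norm f_def abs_rep_l2)
  have "(\<integral>\<^sup>+x. (\<Sum>n. ennreal (4 ^ n * (cmod (f (Suc n) x - f n x))\<^sup>2)) \<partial>lborel) =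
      (\<Sum>n. \<integral>\<^sup>+x. ennreal (4 ^ n * (cmod (f (Suc n) x - f n x))\<^sup>2) \<partial>lborel)"
    by (rule nn_integral_suminf) measurable
  also have "\<dots> = (\<Sum>n. ennreal (4 ^ n * (dist (X (r (Suc n))) (X (r n)))\<^sup>2))"
    by (simp add: ennreal_mult nn_integral_cmult nn)
  also have "\<dots> \<le> (\<Sum>n. ennreal ((1/4) ^ n))"
  proof (intro suminf_le summableI ennreal_leI)
    fix n
    have "(dist (X (r (Suc n))) (X (r n)))\<^sup>2 \<le> ((1/4) ^ n)\<^sup>2"
      using fast[of n "Suc n" n] by (intro power_mono) auto
    then have "4 ^ n * (dist (X (r (Suc n))) (X (r n)))\<^sup>2 \<le> 4 ^ n * ((1/4) ^ n)\<^sup>2"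
      by (intro mult_left_mono) auto
    also have "\<dots> = (1/4) ^ n" by (simp add: power2_eq_square power_divide)
    finally show "4 ^ n * (dist (X (r (Suc n))) (X (r n)))\<^sup>2 \<le> (1/4) ^ n" .
  qed
  also have "\<dots> = ennreal (\<Sum>n. (1/4) ^ n)"
    by (rule suminf_ennreal2) (auto intro: summable_geometric)
  also have "\<dots> < \<infinity>" by simp
  finally have "AE x in lborel. (\<Sum>n. ennreal (4 ^ n * (cmod (f (Suc n) x - f n x))\<^sup>2)) \<noteq> \<infinity>"
    by (intro nn_integral_PInf_AE) auto
  then have conv: "AE x in lborel. convergent (\<lambda>n. f n x)"
    by eventually_elim (rule converges_if_weighted_square_summable)
  define F where "F x = lim (\<lambda>n. f n x)" for x
  have Fm [measurable]: "F \<in> borel_measurable lborel"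
    unfolding F_def by (rule borel_measurable_lim_metric) measurable
  have bound: "(\<integral>\<^sup>+x. ennreal ((cmod (F x - f m x))\<^sup>2) \<partial>lborel) \<le> ennreal (((1/4) ^ m)\<^sup>2)" for m
  proof -
    have "(\<integral>\<^sup>+x. ennreal ((cmod (F x - f m x))\<^sup>2) \<partial>lborel) =
        (\<integral>\<^sup>+x. liminf (\<lambda>n. ennreal ((cmod (f n x - f m x))\<^sup>2)) \<partial>lborel)"
    proof (rule nn_integral_cong_AE)
      from conv show "AE x in lborel. ennreal ((cmod (F x - f m x))\<^sup>2) =
          liminf (\<lambda>n. ennreal ((cmod (f n x - f m x))\<^sup>2))"
      proof eventually_elim
        case (elim x)
        then have "(\<lambda>n. f n x) \<longlonglongrightarrow> F x" unfolding F_def by (simp add: convergent_LIMSEQ_iff)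
        then have "(\<lambda>n. ennreal ((cmod (f n x - f m x))\<^sup>2)) \<longlonglongrightarrow> ennreal ((cmod (F x - f m x))\<^sup>2)"
          by (intro tendsto_ennrealI tendsto_intros)
        then show ?case by (intro lim_imp_Liminf[symmetric]) auto
      qed
    qed
    also have "\<dots> \<le> liminf (\<lambda>n. \<integral>\<^sup>+x. ennreal ((cmod (f n x - f m x))\<^sup>2) \<partial>lborel)"
      by (rule nn_integral_liminf) measurable
    also have "\<dots> \<le> liminf (\<lambda>n. ennreal (((1/4) ^ m)\<^sup>2))"
    proof (rule Liminf_mono)
      show "\<forall>\<^sub>F n in sequentially. (\<integral>\<^sup>+x. ennreal ((cmod (f n x - f m x))\<^sup>2) \<partial>lborel) \<le> ennreal (((1/4) ^ m)\<^sup>2)"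
        using eventually_ge_at_top[of m]
      proof eventually_elim
        case (elim n)
        then show ?case unfolding nn using fast[of m n m] by (intro ennreal_leI power_mono) auto
      qed
    qed
    also have "\<dots> = ennreal (((1/4) ^ m)\<^sup>2)" by (simp add: Liminf_const)
    finally show ?thesis .
  qed
  have diff: "square_integrable (\<lambda>x. F x - f m x)" for m
    unfolding square_integrable_def
    using bound[of m] by (auto intro!: integrableI_bounded simp: less_top[symmetric] top_unique)
  have F: "square_integrable F"
    using square_integrable_add[OF diff f, of 0 0] by simp
  have "dist (X (r m)) (abs_l2 F) \<le> (1/4) ^ m" for m
  proof -
    have "ennreal ((norm (abs_l2 (\<lambda>x. F x - f m x)))\<^sup>2) \<le> ennreal (((1/4) ^ m)\<^sup>2)"
      using bound[of m] nn_integral_eq_norm_abs_l2[OF diff] by simp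
    then have "(norm (abs_l2 (\<lambda>x. F x - f m x)))\<^sup>2 \<le> ((1/4) ^ m)\<^sup>2" by simp
    then have "norm (abs_l2 (\<lambda>x. F x - f m x)) \<le> (1/4) ^ m" by (rule power2_le_imp_le) simp
    then show ?thesis
      using abs_l2_minus[OF F f, of m] by (simp add: dist_norm norm_minus_commute f_def abs_rep_l2)
  qed
  moreover have "(\<lambda>m. (1/4::real) ^ m) \<longlonglongrightarrow> 0" by (intro LIMSEQ_power_zero) simp
  ultimately have "(\<lambda>m. dist (X (r m)) (abs_l2 F)) \<longlonglongrightarrow> 0"
    by (rule_tac Lim_null_comparison[of _ "\<lambda>m. (1/4) ^ m"]) auto
  then have "(X \<circ> r) \<longlonglongrightarrow> abs_l2 F" by (subst tendsto_dist_iff) (simp add: o_def)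
  then show "convergent X" using Cauchy_converges_subseq[OF X r] by (auto simp: convergent_def)
qed

section \<open>Smooth functions\<close>

text \<open>Finite orders of differentiability, peeled off from the first derivative on. This is the form in
which Leibniz-type closure properties go through by induction: the derivative of a product or
inverse is built from functions to which the induction hypothesis applies.\<close>

primrec times_differentiable :: "nat \<Rightarrow> (real \<Rightarrow> complex) \<Rightarrow> bool" where
  "times_differentiable 0 f \<longleftrightarrow> (\<forall>x. f differentiable (at x))"
| "times_differentiable (Suc n) f \<longleftrightarrow> (\<forall>x. f differentiable (at x)) \<and> times_differentiable n (vderiv f)"

lemma times_differentiable_iff:
  "times_differentiable n f \<longleftrightarrow> (\<forall>j\<le>n. \<forall>x. (vderiv ^^ j) f differentiable (at x))"
proof (induction n arbitrary: f)
  case (Suc n)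
  have split: "(\<forall>j\<le>Suc n. P j) \<longleftrightarrow> P 0 \<and> (\<forall>j\<le>n. P (Suc j))" for P
    by (metis Suc_le_mono le0 not0_implies_Suc)
  have "(\<forall>j\<le>Suc n. \<forall>x. (vderiv ^^ j) f differentiable (at x)) \<longleftrightarrow>
      (\<forall>x. f differentiable (at x)) \<and> (\<forall>j\<le>n. \<forall>x. (vderiv ^^ Suc j) f differentiable (at x))"
    by (subst split) simp
  then show ?case by (simp only: times_differentiable.simps Suc.IH funpow_Suc_right o_def)
qed simp

lemma smooth_iff: "smooth f \<longleftrightarrow> (\<forall>n. times_differentiable n f)"
  by (auto simp: smooth_def times_differentiable_iff)

lemma times_differentiable_differentiable: "times_differentiable n f \<Longrightarrow> f differentiable (at x)"
  by (cases n) auto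

lemma times_differentiable_Suc_weaken: "times_differentiable (Suc n) f \<Longrightarrow> times_differentiable n f"
  by (auto simp: times_differentiable_iff)

lemma smooth_differentiable: "smooth f \<Longrightarrow> f differentiable (at x)"
  using times_differentiable_differentiable smooth_iff by blast

lemma smooth_has_vector_derivative: "smooth f \<Longrightarrow> (f has_vector_derivative vderiv f x) (at x)"
  by (simp add: smooth_differentiable vector_derivative_works[symmetric])

lemma smooth_continuous_on: "smooth f \<Longrightarrow> continuous_on S f"
  by (meson continuous_at_imp_continuous_on differentiable_imp_continuous_within smooth_differentiable)

lemma smooth_vderiv: "smooth f \<Longrightarrow> smooth (vderiv f)"
  unfolding smooth_iff by (metis times_differentiable.simps(2))

lemma times_differentiable_SucI:
  assumes "\<And>x. (f has_vector_derivative f' x) (at x)" "times_differentiable n f'"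
  shows "times_differentiable (Suc n) f"
proof -
  have "vderiv f = f'" using assms(1) by (intro ext vector_derivative_at)
  then show ?thesis using assms by (auto intro: differentiableI_vector)
qed

lemma times_differentiable_0I:
  assumes "\<And>x. (f has_vector_derivative f' x) (at x)"
  shows "times_differentiable 0 f"
  using assms by (auto intro: differentiableI_vector)

lemma times_differentiable_has_vector_derivative:
  "times_differentiable n f \<Longrightarrow> (f has_vector_derivative vderiv f x) (at x)"
  using times_differentiable_differentiable vector_derivative_works by blast

lemma times_differentiable_const: "times_differentiable n (\<lambda>x. c)"
  by (induction n arbitrary: c) auto

lemma times_differentiable_add:
  "times_differentiable n f \<Longrightarrow> times_differentiable n g \<Longrightarrow> times_differentiable n (\<lambda>x. f x + g x)"
proof (induction n arbitrary: f g)
  case (Suc n)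
  show ?case
    by (rule times_differentiable_SucI[where f' = "\<lambda>x. vderiv f x + vderiv g x"])
      (use Suc times_differentiable_has_vector_derivative[OF Suc.prems(1)]
          times_differentiable_has_vector_derivative[OF Suc.prems(2)]
        in \<open>auto intro!: has_vector_derivative_add\<close>)
qed auto

lemma times_differentiable_mult:
  "times_differentiable n f \<Longrightarrow> times_differentiable n g \<Longrightarrow> times_differentiable n (\<lambda>x. f x * g x)"
proof (induction n arbitrary: f g)
  case (Suc n)
  have "times_differentiable n f" "times_differentiable n g"
    using Suc.prems by (auto intro: times_differentiable_Suc_weaken simp del: times_differentiable.simps)
  moreover have "times_differentiable n (vderiv f)" "times_differentiable n (vderiv g)"
    using Suc.prems by auto
  ultimately have "times_differentiable n (\<lambda>x. f x * vderiv g x + vderiv f x * g x)"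
    by (intro times_differentiable_add Suc.IH)
  then show ?case
    by (rule times_differentiable_SucI[rotated])
      (intro has_vector_derivative_mult times_differentiable_has_vector_derivative[OF Suc.prems(1)]
        times_differentiable_has_vector_derivative[OF Suc.prems(2)])
qed auto

lemma smooth_const: "smooth (\<lambda>x. c)"
  by (simp add: smooth_iff times_differentiable_const)

lemma smooth_add: "smooth f \<Longrightarrow> smooth g \<Longrightarrow> smooth (\<lambda>x. f x + g x)"
  by (simp add: smooth_iff times_differentiable_add)

lemma smooth_mult: "smooth f \<Longrightarrow> smooth g \<Longrightarrow> smooth (\<lambda>x. f x * g x)"
  by (simp add: smooth_iff times_differentiable_mult)

lemma smooth_cmult: "smooth f \<Longrightarrow> smooth (\<lambda>x. c * f x)"
  by (intro smooth_mult smooth_const)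

lemma smooth_diff: "smooth f \<Longrightarrow> smooth g \<Longrightarrow> smooth (\<lambda>x. f x - g x)"
  using smooth_add[of f "\<lambda>x. (-1) * g x"] smooth_cmult[of g "-1"] by simp

lemma smooth_sum: "(\<And>j. j \<in> J \<Longrightarrow> smooth (f j)) \<Longrightarrow> smooth (\<lambda>x. \<Sum>j\<in>J. f j x)"
  by (induction J rule: infinite_finite_induct) (auto intro!: smooth_const smooth_add)

text \<open>The derivative of $1/f$ is $-f' \cdot (1/f) \cdot (1/f)$, which has $n$ derivatives as soon as
$1/f$ has.\<close>

lemma smooth_inverse:
  assumes f: "smooth f" and nz: "\<And>x. f x \<noteq> 0"
  shows "smooth (\<lambda>x. inverse (f x))"
proof -
  have der: "((\<lambda>x. inverse (f x)) has_vector_derivative (-1) * vderiv f x * (inverse (f x) * inverse (f x))) (at x)" for x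
    using field_vector_diff_chain_at[OF smooth_has_vector_derivative[OF f] DERIV_inverse[OF nz]]
    by (simp add: o_def power2_eq_square mult_ac)
  have "times_differentiable n (\<lambda>x. inverse (f x))" for n
  proof (induction n)
    case 0
    show ?case using der by (rule times_differentiable_0I)
  next
    case (Suc n)
    show ?case
      by (rule times_differentiable_SucI[OF der])
        (intro times_differentiable_mult times_differentiable_const Suc
          smooth_vderiv[OF f, unfolded smooth_iff, rule_format])
  qed
  then show ?thesis by (simp add: smooth_iff)
qed

lemma smooth_exp: "smooth (\<lambda>x. exp (c * of_real x))"
proof -
  have der: "((\<lambda>x. exp (c * of_real x)) has_vector_derivative c * exp (c * of_real x)) (at x)" for x
  proof -
    have "((\<lambda>z. exp (c * z)) has_field_derivative c * exp (c * of_real x)) (at (of_real x))"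
      by (auto intro!: derivative_eq_intros)
    then show ?thesis using has_vector_derivative_real_field by blast
  qed
  have "times_differentiable n (\<lambda>x. exp (c * of_real x))" for n
  proof (induction n)
    case 0
    show ?case using der by (rule times_differentiable_0I)
  next
    case (Suc n)
    show ?case
      by (rule times_differentiable_SucI[OF der]) (intro times_differentiable_mult times_differentiable_const Suc)
  qed
  then show ?thesis by (simp add: smooth_iff)
qed

section \<open>Smooth functions with prescribed support\<close>

text \<open>The classical functions $x^{-q} e^{-1/x}$ on the positive half line, extended by zero. The family
over all $q$ is closed under differentiation up to linear combinations, which makes each member
smooth.\<close>

definition flat :: "nat \<Rightarrow> real \<Rightarrow> real" where
  "flat q x = (if x > 0 then inverse x ^ q * exp (- inverse x) else 0)"

lemma flat_isCont_0: "isCont (flat q) 0"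
proof -
  have "((\<lambda>x. x ^ q / exp x) \<longlongrightarrow> 0) (at_top :: real filter)" by (rule tendsto_power_div_exp_0)
  then have "((\<lambda>x. inverse x ^ q / exp (inverse x)) \<longlongrightarrow> 0) (at_right (0::real))"
    by (rule filterlim_compose[OF _ filterlim_inverse_at_top_right])
  then have "(flat q \<longlongrightarrow> 0) (at_right 0)"
    by (rule Lim_transform_eventually)
      (auto simp: flat_def eventually_at_right_less exp_minus divide_inverse eventually_at_filter)
  moreover have "(flat q \<longlongrightarrow> 0) (at_left 0)"
    by (rule tendsto_eventually) (auto simp: flat_def eventually_at_filter)
  ultimately show ?thesis by (simp add: isCont_def filterlim_split_at flat_def)
qed

text \<open>At the origin the difference quotient of \<^term>\<open>flat q\<close> is the next member of the family, so
differentiability there is continuity of that member.\<close>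

lemma flat_has_derivative: "(flat q has_real_derivative - real q * flat (Suc q) x + flat (q + 2) x) (at x)"
proof -
  consider "x < 0" | "x = 0" | "x > 0" by linarith
  then show ?thesis
  proof cases
    case 1
    have "((\<lambda>x. 0) has_real_derivative 0) (at x)" by simp
    then have "(flat q has_real_derivative 0) (at x)"
      by (rule has_field_derivative_transform_within_open[of _ _ _ "{..<0}"]) (use 1 in \<open>auto simp: flat_def\<close>)
    then show ?thesis using 1 by (simp add: flat_def)
  next
    case 2
    have "flat q z - flat q 0 = flat (Suc q) z * (z - 0)" for z
      by (auto simp: flat_def)
    then have "(flat q has_real_derivative flat (Suc q) 0) (at 0)"
      using flat_isCont_0 by (auto simp: CARAT_DERIV)
    then show ?thesis using 2 by (simp add: flat_def)
  next
    case 3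
    have "((\<lambda>x. inverse x ^ q * exp (- inverse x)) has_real_derivative
        inverse x ^ q * (inverse x ^ 2 * exp (- inverse x)) + real q * inverse x ^ (q - 1) * (- (inverse x ^ 2)) * exp (- inverse x)) (at x)"
      using 3 by (auto intro!: derivative_eq_intros simp: power2_eq_square)
    also have "inverse x ^ q * (inverse x ^ 2 * exp (- inverse x)) + real q * inverse x ^ (q - 1) * (- (inverse x ^ 2)) * exp (- inverse x)
        = - real q * flat (Suc q) x + flat (q + 2) x"
      using 3 by (cases q) (simp_all add: flat_def power2_eq_square algebra_simps)
    finally show ?thesis
      by (rule has_field_derivative_transform_within_open[of _ _ _ "{0<..}"]) (use 3 in \<open>auto simp: flat_def\<close>)
  qed
qed

lemma smooth_flat: "smooth (\<lambda>x. of_real (flat q (s * x + t)))"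
proof -
  have der: "((\<lambda>x. complex_of_real (flat q (s * x + t))) has_vector_derivative
      of_real (s * - real q) * of_real (flat (Suc q) (s * x + t)) + of_real s * of_real (flat (q + 2) (s * x + t))) (at x)"
    for q x
  proof -
    have "((\<lambda>x. flat q (s * x + t)) has_real_derivative
        (- real q * flat (Suc q) (s * x + t) + flat (q + 2) (s * x + t)) * s) (at x)"
      by (rule DERIV_chain2[OF flat_has_derivative]) (auto intro!: derivative_eq_intros)
    then have "((\<lambda>x. complex_of_real (flat q (s * x + t))) has_vector_derivative
        of_real ((- real q * flat (Suc q) (s * x + t) + flat (q + 2) (s * x + t)) * s)) (at x)"
      by (intro has_vector_derivative_of_real) (simp add: has_real_derivative_iff_has_vector_derivative)
    then show ?thesis by (simp add: algebra_simps)
  qed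
  have "times_differentiable n (\<lambda>x. of_real (flat q (s * x + t)))" for n q
  proof (induction n arbitrary: q)
    case 0
    show ?case using der by (rule times_differentiable_0I)
  next
    case (Suc n)
    show ?case
      by (rule times_differentiable_SucI[OF der])
        (intro times_differentiable_mult times_differentiable_add times_differentiable_const Suc)
  qed
  then show ?thesis by (simp add: smooth_iff)
qed

text \<open>Unlike \<^const>\<open>test_function\<close>, this fixes the set outside which the function vanishes. Sums of
functions supported in the same set stay in the class without any topological argument, and
supports can be kept disjoint.\<close>

definition smooth_supported :: "real set \<Rightarrow> (real \<Rightarrow> complex) \<Rightarrow> bool" where
  "smooth_supported K w \<longleftrightarrow> smooth w \<and> (\<forall>x. x \<notin> K \<longrightarrow> w x = 0)"

lemma smooth_supported_imp_smooth: "smooth_supported K w \<Longrightarrow> smooth w"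
  by (simp add: smooth_supported_def)

lemma smooth_supported_outside: "smooth_supported K w \<Longrightarrow> x \<notin> K \<Longrightarrow> w x = 0"
  by (simp add: smooth_supported_def)

lemma smooth_supported_zero: "smooth_supported K (\<lambda>x. 0)"
  by (simp add: smooth_supported_def smooth_const)

lemma smooth_supported_add:
  "smooth_supported K v \<Longrightarrow> smooth_supported K w \<Longrightarrow> smooth_supported K (\<lambda>x. v x + w x)"
  by (simp add: smooth_supported_def smooth_add)

lemma smooth_supported_mult: "smooth f \<Longrightarrow> smooth_supported K w \<Longrightarrow> smooth_supported K (\<lambda>x. f x * w x)"
  by (simp add: smooth_supported_def smooth_mult)

lemma smooth_supported_cmult: "smooth_supported K w \<Longrightarrow> smooth_supported K (\<lambda>x. c * w x)"
  by (intro smooth_supported_mult smooth_const)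

lemma smooth_supported_mono: "smooth_supported K w \<Longrightarrow> K \<subseteq> L \<Longrightarrow> smooth_supported L w"
  by (auto simp: smooth_supported_def)

lemma smooth_supported_D:
  assumes "smooth_supported K w" "closed K"
  shows "smooth_supported K (D w)"
proof -
  have "vderiv w x = 0" if "x \<notin> K" for x
  proof -
    have "((\<lambda>x. 0) has_vector_derivative 0) (at x)" by simp
    then have "(w has_vector_derivative 0) (at x)"
      by (rule has_vector_derivative_transform_within_open[of _ _ _ "- K"])
        (use that assms in \<open>auto simp: smooth_supported_def open_Compl\<close>)
    then show ?thesis by (rule vector_derivative_at)
  qed
  then show ?thesis using assms
    unfolding smooth_supported_def D_def using smooth_cmult[OF smooth_vderiv, of w "- \<i>"] by auto
qed

lemma smooth_supported_imp_test_function: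
  assumes "smooth_supported K w" "compact K"
  shows "test_function w"
proof -
  have "{x. w x \<noteq> 0} \<subseteq> K" using assms by (auto simp: smooth_supported_def)
  then have "bounded {x. w x \<noteq> 0}" using assms(2) compact_imp_bounded bounded_subset by blast
  then show ?thesis using assms by (simp add: test_function_def smooth_supported_def)
qed

lemma test_function_iff_smooth_supported:
  "test_function w \<longleftrightarrow> (\<exists>K. compact K \<and> smooth_supported K w)"
proof
  assume "test_function w"
  then show "\<exists>K. compact K \<and> smooth_supported K w"
    using closure_subset[of "{x. w x \<noteq> 0}"]
    by (intro exI[of _ "closure {x. w x \<noteq> 0}"]) (auto simp: test_function_def smooth_supported_def)
qed (auto intro: smooth_supported_imp_test_function)

lemma smooth_supported_square_integrable:
  assumes w: "smooth_supported K w" and K: "compact K"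
  shows "square_integrable w"
proof -
  have c: "continuous_on S w" for S using w by (intro smooth_continuous_on) (simp add: smooth_supported_def)
  have "integrable lborel (\<lambda>x. indicator K x *\<^sub>R (cmod (w x))\<^sup>2)"
    by (rule borel_integrable_compact[OF K]) (intro continuous_intros c)
  also have "(\<lambda>x. indicator K x *\<^sub>R (cmod (w x))\<^sup>2) = (\<lambda>x. (cmod (w x))\<^sup>2)"
    using w by (auto simp: smooth_supported_def indicator_def fun_eq_iff)
  finally show ?thesis
    using c[of UNIV] by (simp add: square_integrable_def borel_measurable_continuous_onI)
qed

text \<open>The product of two flat functions facing each other vanishes exactly outside the open interval, so
it is not zero almost everywhere and can be normalized.\<close>

lemma normalized_bump_exists:
  assumes "\<alpha> < \<beta>"
  shows "\<exists>w. smooth_supported {\<alpha>..\<beta>} w \<and> norm (abs_l2 w) = 1"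
proof -
  define w where "w x = complex_of_real (flat 0 (1 * x + - \<alpha>)) * of_real (flat 0 ((-1) * x + \<beta>))" for x
  have w: "smooth_supported {\<alpha>..\<beta>} w"
    unfolding smooth_supported_def
  proof (intro conjI allI impI)
    show "smooth w" unfolding w_def by (intro smooth_mult smooth_flat)
    show "w x = 0" if "x \<notin> {\<alpha>..\<beta>}" for x using that by (auto simp: w_def flat_def)
  qed
  have sq: "square_integrable w" using smooth_supported_square_integrable[OF w] by simp
  have "norm (abs_l2 w) \<noteq> 0"
  proof
    assume "norm (abs_l2 w) = 0"
    then have "(\<integral>x. (cmod (w x))\<^sup>2 \<partial>lborel) = 0" by (simp only: norm_abs_l2[OF sq] real_sqrt_eq_zero_cancel_iff)
    then have "AE x in lborel. (cmod (w x))\<^sup>2 = 0"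
      using sq by (subst (asm) integral_nonneg_eq_0_iff_AE) (auto simp: square_integrable_def)
    then have "AE x in lborel. \<not> (\<alpha> < x \<and> x < \<beta>)"
      by eventually_elim (auto simp: w_def flat_def)
    then have "emeasure lborel {x\<in>space lborel. \<alpha> < x \<and> x < \<beta>} = 0"
      by (rule emeasure_eq_0_AE)
    moreover have "{x\<in>space lborel. \<alpha> < x \<and> x < \<beta>} = {\<alpha><..<\<beta>}" by auto
    ultimately show False using assms by simp
  qed
  then have "norm (of_real (inverse (norm (abs_l2 w))) *\<^sub>C abs_l2 w) = 1"
    by (simp only: norm_scaleC norm_of_real) simp
  then have "norm (abs_l2 (\<lambda>x. of_real (inverse (norm (abs_l2 w))) * w x)) = 1"
    by (simp only: abs_l2_scaleC[OF sq])
  moreover have "smooth_supported {\<alpha>..\<beta>} (\<lambda>x. of_real (inverse (norm (abs_l2 w))) * w x)"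
    by (rule smooth_supported_mult[OF smooth_const w])
  ultimately show ?thesis by blast
qed

section \<open>Differential operators\<close>

lemma smooth_D: "smooth f \<Longrightarrow> smooth (D f)"
  unfolding D_def by (intro smooth_cmult smooth_vderiv)

lemma D_add: "smooth f \<Longrightarrow> smooth g \<Longrightarrow> D (\<lambda>x. f x + g x) = (\<lambda>x. D f x + D g x)"
proof
  fix x assume "smooth f" "smooth g"
  then have "((\<lambda>x. f x + g x) has_vector_derivative vderiv f x + vderiv g x) (at x)"
    by (intro has_vector_derivative_add smooth_has_vector_derivative)
  then show "D (\<lambda>x. f x + g x) x = D f x + D g x"
    by (simp add: D_def vector_derivative_at algebra_simps)
qed

lemma D_mult: "smooth f \<Longrightarrow> smooth g \<Longrightarrow> D (\<lambda>x. f x * g x) = (\<lambda>x. D f x * g x + f x * D g x)"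
proof
  fix x assume "smooth f" "smooth g"
  then have "((\<lambda>x. f x * g x) has_vector_derivative f x * vderiv g x + vderiv f x * g x) (at x)"
    by (intro has_vector_derivative_mult smooth_has_vector_derivative)
  then show "D (\<lambda>x. f x * g x) x = D f x * g x + f x * D g x"
    by (simp add: D_def vector_derivative_at algebra_simps)
qed

lemma D_cmult: "smooth f \<Longrightarrow> D (\<lambda>x. c * f x) = (\<lambda>x. c * D f x)"
  using D_mult[OF smooth_const[of c], of f] by (simp add: D_def)

lemma smooth_D_funpow: "smooth f \<Longrightarrow> smooth ((D ^^ j) f)"
  by (induction j) (simp_all add: smooth_D)

lemma D_funpow_add:
  "smooth f \<Longrightarrow> smooth g \<Longrightarrow> (D ^^ j) (\<lambda>x. f x + g x) = (\<lambda>x. (D ^^ j) f x + (D ^^ j) g x)"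
  by (induction j) (simp_all add: D_add smooth_D_funpow)

lemma D_funpow_cmult: "smooth f \<Longrightarrow> (D ^^ j) (\<lambda>x. c * f x) = (\<lambda>x. c * (D ^^ j) f x)"
  by (induction j) (simp_all add: D_cmult smooth_D_funpow)

lemma diff_op_add:
  "smooth f \<Longrightarrow> smooth g \<Longrightarrow> diff_op N p (\<lambda>x. f x + g x) = (\<lambda>x. diff_op N p f x + diff_op N p g x)"
  by (simp add: diff_op_def D_funpow_add distrib_left sum.distrib)

lemma diff_op_cmult: "smooth f \<Longrightarrow> diff_op N p (\<lambda>x. c * f x) = (\<lambda>x. c * diff_op N p f x)"
  by (simp add: diff_op_def D_funpow_cmult sum_distrib_left mult.left_commute)

lemma diff_op_minus:
  assumes "smooth f" "smooth g"
  shows "diff_op N p (\<lambda>x. f x - g x) = (\<lambda>x. diff_op N p f x - diff_op N p g x)"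
  using diff_op_add[OF assms(1) smooth_cmult[OF assms(2)], of N p "-1"] diff_op_cmult[OF assms(2), of N p "-1"]
  by simp

lemma diff_op_shift:
  assumes "p' = p(0 := \<lambda>x. p 0 x - z)"
  shows "diff_op N p' f = (\<lambda>x. diff_op N p f x - z * f x)"
proof
  fix x
  have "diff_op N p' f x = (\<Sum>j\<le>N. p j x * (D ^^ j) f x - (if j = 0 then z * f x else 0))"
    unfolding diff_op_def by (rule sum.cong) (auto simp: assms algebra_simps)
  also have "\<dots> = diff_op N p f x - z * f x"
    by (simp add: diff_op_def sum_subtractf)
  finally show "diff_op N p' f x = diff_op N p f x - z * f x" .
qed

lemma smooth_supported_D_funpow: "smooth_supported K w \<Longrightarrow> closed K \<Longrightarrow> smooth_supported K ((D ^^ j) w)"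
  by (induction j) (simp_all add: smooth_supported_D)

lemma smooth_supported_diff_op:
  assumes "smooth_supported K w" "closed K" "\<And>j. j \<le> N \<Longrightarrow> smooth (p j)"
  shows "smooth_supported K (diff_op N p w)"
proof -
  have "smooth_supported K (\<lambda>x. p j x * (D ^^ j) w x)" if "j \<le> N" for j
    using that assms by (intro smooth_supported_mult smooth_supported_D_funpow)
  then show ?thesis
    unfolding smooth_supported_def diff_op_def by (auto intro!: smooth_sum sum.neutral)
qed

section \<open>Finite expansions in powers of a large frequency\<close>

text \<open>A term $\xi^q e^{i \xi x} w(x)$. The frequency runs through the positive integers
$\xi = N + 1$, so that negative powers make sense for every index and the limit of large
frequency is a limit of sequences.\<close>

definition wave :: "int \<Rightarrow> (real \<Rightarrow> complex) \<Rightarrow> nat \<Rightarrow> real \<Rightarrow> complex" where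
  "wave q w N x = of_nat (Suc N) powi q * exp (\<i> * of_nat (Suc N) * of_real x) * w x"

text \<open>Finite sums of waves of order at most $p$ with amplitudes supported in $K$: a calculus of finite
expansions in which a differential operator of order $r$ raises the order by $r$.\<close>

inductive oscillating :: "real set \<Rightarrow> int \<Rightarrow> (nat \<Rightarrow> real \<Rightarrow> complex) \<Rightarrow> bool" for K where
  zero: "oscillating K p (\<lambda>N x. 0)"
| add_wave: "q \<le> p \<Longrightarrow> smooth_supported K w \<Longrightarrow> oscillating K p g \<Longrightarrow> oscillating K p (\<lambda>N x. wave q w N x + g N x)"

lemma wave_add: "wave q (\<lambda>x. v x + w x) = (\<lambda>N x. wave q v N x + wave q w N x)"
  by (simp add: wave_def fun_eq_iff algebra_simps)

lemma wave_mult: "wave q (\<lambda>x. f x * w x) = (\<lambda>N x. f x * wave q w N x)"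
  by (simp add: wave_def fun_eq_iff)

lemma wave_zero: "wave q (\<lambda>x. 0) = (\<lambda>N x. 0)"
  by (simp add: wave_def fun_eq_iff)

lemma smooth_supported_wave: "smooth_supported K w \<Longrightarrow> smooth_supported K (wave q w N)"
  unfolding wave_def by (intro smooth_supported_mult smooth_mult smooth_const smooth_exp)

text \<open>One derivative either falls on the exponential, which raises the power of the frequency, or on the
amplitude, which keeps it.\<close>

lemma D_wave:
  assumes w: "smooth w"
  shows "D (wave q w N) = (\<lambda>x. wave (q + 1) w N x + wave q (D w) N x)"
proof
  fix x
  define c :: complex where "c = of_nat (Suc N)"
  have c: "c \<noteq> 0" unfolding c_def by (simp del: of_nat_Suc)
  have e: "((\<lambda>x. exp (\<i> * c * of_real x)) has_vector_derivative \<i> * c * exp (\<i> * c * of_real x)) (at x)"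
  proof -
    have "((\<lambda>z. exp (\<i> * c * z)) has_field_derivative \<i> * c * exp (\<i> * c * of_real x)) (at (of_real x))"
      by (auto intro!: derivative_eq_intros)
    then show ?thesis using has_vector_derivative_real_field by blast
  qed
  have "((\<lambda>x. c powi q * exp (\<i> * c * of_real x) * w x) has_vector_derivative
      c powi q * exp (\<i> * c * of_real x) * vderiv w x + c powi q * (\<i> * c * exp (\<i> * c * of_real x)) * w x) (at x)"
    by (intro has_vector_derivative_mult has_vector_derivative_mult_right e smooth_has_vector_derivative w)
  then have "vderiv (wave q w N) x =
      c powi q * exp (\<i> * c * of_real x) * vderiv w x + c powi q * (\<i> * c * exp (\<i> * c * of_real x)) * w x"
    unfolding wave_def c_def by (rule vector_derivative_at)
  then show "D (wave q w N) x = wave (q + 1) w N x + wave q (D w) N x"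
    using c power_int_add_1[of c q] unfolding D_def wave_def c_def[symmetric] by (simp add: algebra_simps)
qed

lemma oscillating_mono: "oscillating K p g \<Longrightarrow> p \<le> p' \<Longrightarrow> oscillating K p' g"
  by (induction rule: oscillating.induct) (auto intro!: oscillating.intros)

lemma oscillating_wave: "smooth_supported K w \<Longrightarrow> q \<le> p \<Longrightarrow> oscillating K p (wave q w)"
  using oscillating.add_wave[OF _ _ oscillating.zero, of q p K w] by (simp add: fun_eq_iff)

lemma oscillating_add:
  "oscillating K p g \<Longrightarrow> oscillating K p h \<Longrightarrow> oscillating K p (\<lambda>N x. g N x + h N x)"
  by (induction rule: oscillating.induct) (auto simp: add.assoc intro!: oscillating.intros)

lemma oscillating_mult:
  "oscillating K p g \<Longrightarrow> smooth f \<Longrightarrow> oscillating K p (\<lambda>N x. f x * g N x)"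
proof (induction rule: oscillating.induct)
  case zero
  then show ?case by (simp add: oscillating.zero)
next
  case (add_wave q p w g)
  have "oscillating K p (\<lambda>N x. wave q (\<lambda>x. f x * w x) N x + f x * g N x)"
    using add_wave by (intro oscillating.add_wave smooth_supported_mult)
  then show ?case by (simp only: wave_mult distrib_left)
qed

lemma oscillating_imp_smooth_supported: "oscillating K p g \<Longrightarrow> smooth_supported K (g N)"
  by (induction rule: oscillating.induct)
    (auto intro: smooth_supported_zero intro!: smooth_supported_add smooth_supported_wave)

lemma oscillating_D:
  assumes K: "closed K"
  shows "oscillating K p g \<Longrightarrow> oscillating K (p + 1) (\<lambda>N. D (g N))"
proof (induction rule: oscillating.induct)
  case zero
  have "D (\<lambda>x. 0) = (\<lambda>x. 0)" by (simp add: D_def fun_eq_iff)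
  then show ?case by (simp add: oscillating.zero)
next
  case (add_wave q p w g)
  have "smooth w" "smooth (wave q w N)" "smooth (g N)" for N
    using add_wave(2,3) smooth_supported_imp_smooth smooth_supported_wave oscillating_imp_smooth_supported by blast+
  then have "D (\<lambda>x. wave q w N x + g N x) = (\<lambda>x. wave (q + 1) w N x + (wave q (D w) N x + D (g N) x))" for N
    by (simp add: D_add D_wave add.assoc)
  then show ?case
    using add_wave K by (simp only:) (intro oscillating.add_wave smooth_supported_D; simp)
qed

text \<open>The amplitude $w$ in front of the top power; it is allowed to be zero. In particular
leading amplitude zero expresses a gain of one order.\<close>

definition leading :: "real set \<Rightarrow> int \<Rightarrow> (real \<Rightarrow> complex) \<Rightarrow> (nat \<Rightarrow> real \<Rightarrow> complex) \<Rightarrow> bool" where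
  "leading K p w g \<longleftrightarrow> smooth_supported K w \<and> oscillating K (p - 1) (\<lambda>N x. g N x - wave p w N x)"

lemma leading_wave: "smooth_supported K w \<Longrightarrow> leading K p w (wave p w)"
  by (simp add: leading_def oscillating.zero)

lemma leading_imp_oscillating: "leading K p w g \<Longrightarrow> oscillating K p g"
  unfolding leading_def
  using oscillating.add_wave[of p p K w "\<lambda>N x. g N x - wave p w N x"]
    oscillating_mono[of K "p - 1" "\<lambda>N x. g N x - wave p w N x" p]
  by auto

text \<open>Cancellation of leading amplitudes lowers the order; this is how each step of the WKB recursion
makes progress.\<close>

lemma leading_zero_iff: "leading K p (\<lambda>x. 0) g \<longleftrightarrow> oscillating K (p - 1) g"
  by (simp add: leading_def smooth_supported_zero wave_zero)

lemma leading_add: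
  assumes "leading K p v g" "leading K p w h"
  shows "leading K p (\<lambda>x. v x + w x) (\<lambda>N x. g N x + h N x)"
proof -
  have "oscillating K (p - 1) (\<lambda>N x. (g N x - wave p v N x) + (h N x - wave p w N x))"
    using assms unfolding leading_def by (intro oscillating_add) auto
  then show ?thesis using assms
    unfolding leading_def wave_add by (auto simp: algebra_simps intro: smooth_supported_add)
qed

lemma leading_mult:
  assumes "leading K p w g" "smooth f"
  shows "leading K p (\<lambda>x. f x * w x) (\<lambda>N x. f x * g N x)"
proof -
  have "oscillating K (p - 1) (\<lambda>N x. f x * (g N x - wave p w N x))"
    using assms unfolding leading_def by (intro oscillating_mult) auto
  then show ?thesis using assms
    unfolding leading_def wave_mult by (auto simp: algebra_simps intro: smooth_supported_mult)
qed

lemma leading_diff: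
  assumes "leading K p v g" "leading K p w h"
  shows "leading K p (\<lambda>x. v x - w x) (\<lambda>N x. g N x - h N x)"
  using leading_add[OF assms(1) leading_mult[OF assms(2) smooth_const[of "-1"]]] by simp

text \<open>This supplies the amplitude of the error that the next step of the WKB recursion has to remove.\<close>

lemma oscillating_imp_leading:
  "oscillating K p g \<Longrightarrow> \<exists>w. leading K p w g"
proof (induction rule: oscillating.induct)
  case (zero p)
  show ?case by (rule exI[of _ "\<lambda>x. 0"]) (simp add: leading_zero_iff oscillating.zero)
next
  case (add_wave q p w g)
  then obtain v where v: "leading K p v g" by auto
  have "\<exists>u. leading K p u (wave q w)"
  proof (cases "q = p")
    case True
    then show ?thesis using leading_wave add_wave by blast
  next
    case False
    then have "leading K p (\<lambda>x. 0) (wave q w)"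
      using add_wave by (simp add: leading_zero_iff oscillating_wave)
    then show ?thesis by blast
  qed
  then show ?case using leading_add v by blast
qed

lemma leading_D:
  assumes "leading K p w g" "closed K"
  shows "leading K (p + 1) w (\<lambda>N. D (g N))"
proof -
  define r where "r N x = g N x - wave p w N x" for N x
  have r: "oscillating K (p - 1) r" and w: "smooth_supported K w"
    using assms unfolding leading_def r_def by auto
  have g: "g N = (\<lambda>x. wave p w N x + r N x)" for N by (simp add: r_def)
  have "smooth w" "smooth (wave p w N)" "smooth (r N)" for N
    using w r smooth_supported_imp_smooth smooth_supported_wave oscillating_imp_smooth_supported by blast+
  then have "D (g N) x - wave (p + 1) w N x = wave p (D w) N x + D (r N) x" for N x
    unfolding g by (simp add: D_add D_wave)
  moreover have "oscillating K p (\<lambda>N x. wave p (D w) N x + D (r N) x)"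
    using oscillating_D[OF assms(2) r] w assms(2) by (intro oscillating.add_wave smooth_supported_D) auto
  ultimately show ?thesis using w by (simp add: leading_def)
qed

lemma leading_D_funpow:
  assumes "leading K p w g" "closed K"
  shows "leading K (p + int j) w (\<lambda>N. (D ^^ j) (g N))"
proof (induction j)
  case (Suc j)
  then show ?case using leading_D[OF Suc assms(2)] by (simp add: add_ac)
qed (simp add: assms)

text \<open>Only the term of highest order in the operator contributes to the leading amplitude; its
coefficient acts there as the principal symbol at frequency one.\<close>

lemma leading_diff_op:
  assumes g: "leading K p w g" and K: "closed K" and a: "\<And>j. j \<le> n \<Longrightarrow> smooth (a j)"
  shows "leading K (p + int n) (\<lambda>x. a n x * w x) (\<lambda>N. diff_op n a (g N))"
  using a
proof (induction n)
  case 0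
  then show ?case using leading_mult[OF g, of "a 0"] by (simp add: diff_op_def)
next
  case (Suc n)
  have "oscillating K (p + int n) (\<lambda>N. diff_op n a (g N))"
    using Suc by (intro leading_imp_oscillating) auto
  then have "leading K (p + int (Suc n)) (\<lambda>x. 0) (\<lambda>N. diff_op n a (g N))"
    by (simp add: leading_zero_iff add_ac)
  moreover have "leading K (p + int (Suc n)) (\<lambda>x. a (Suc n) x * w x) (\<lambda>N x. a (Suc n) x * (D ^^ Suc n) (g N) x)"
    using Suc.prems by (intro leading_mult leading_D_funpow g K) auto
  ultimately have "leading K (p + int (Suc n)) (\<lambda>x. 0 + a (Suc n) x * w x)
      (\<lambda>N x. diff_op n a (g N) x + a (Suc n) x * (D ^^ Suc n) (g N) x)"
    by (rule leading_add)
  then show ?case by (simp add: diff_op_def)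
qed

text \<open>The exponential has modulus one, so a wave has the norm of its amplitude up to the power of the
frequency.\<close>

lemma norm_wave:
  assumes "smooth_supported K w" "compact K"
  shows "norm (abs_l2 (wave q w N)) = real (Suc N) powi q * norm (abs_l2 w)"
proof -
  have w: "square_integrable w" "square_integrable (wave q w N)"
    using assms smooth_supported_wave smooth_supported_square_integrable by blast+
  have "cmod (wave q w N x) = real (Suc N) powi q * cmod (w x)" for x
  proof -
    have "cmod (of_nat (Suc N) powi q) = real (Suc N) powi q"
      by (simp only: norm_power_int norm_of_nat)
    moreover have "cmod (exp (\<i> * of_nat (Suc N) * of_real x)) = 1"
      using norm_exp_i_times[of "real (Suc N) * x"] by (simp add: mult.assoc)
    ultimately show ?thesis by (simp add: wave_def norm_mult)
  qed
  then have "(\<integral>x. (cmod (wave q w N x))\<^sup>2 \<partial>lborel) = (real (Suc N) powi q)\<^sup>2 * (\<integral>x. (cmod (w x))\<^sup>2 \<partial>lborel)"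
    by (simp add: power_mult_distrib)
  then show ?thesis
    unfolding norm_abs_l2[OF w(1)] norm_abs_l2[OF w(2)] by (simp add: real_sqrt_mult)
qed

lemma oscillating_negative_tendsto_0:
  assumes K: "compact K"
  shows "oscillating K p g \<Longrightarrow> p < 0 \<Longrightarrow> (\<lambda>N. abs_l2 (g N)) \<longlonglongrightarrow> 0"
proof (induction rule: oscillating.induct)
  case zero
  then show ?case by (simp add: zero_l2_def[symmetric])
next
  case (add_wave q p w g)
  have sq: "square_integrable (wave q w N)" "square_integrable (g N)" for N
    using add_wave K smooth_supported_wave smooth_supported_square_integrable
      oscillating_imp_smooth_supported by blast+
  have "norm (abs_l2 (wave q w N)) \<le> inverse (real (Suc N)) * norm (abs_l2 w)" for N
  proof -
    have "real (Suc N) powi q \<le> real (Suc N) powi (- 1)"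
      using add_wave by (intro power_int_increasing) auto
    also have "\<dots> = inverse (real (Suc N))" by (rule power_int_minus1_right)
    finally show ?thesis
      unfolding norm_wave[OF add_wave(2) K] by (intro mult_right_mono) auto
  qed
  moreover have "(\<lambda>N. inverse (real (Suc N)) * norm (abs_l2 w)) \<longlonglongrightarrow> 0"
    by (rule tendsto_mult_left_zero[OF LIMSEQ_inverse_real_of_nat])
  ultimately have "(\<lambda>N. abs_l2 (wave q w N)) \<longlonglongrightarrow> 0"
    by (rule Lim_null_comparison[OF always_eventually[OF allI]])
  then have "(\<lambda>N. abs_l2 (wave q w N) + abs_l2 (g N)) \<longlonglongrightarrow> 0 + 0"
    using add_wave by (intro tendsto_add) auto
  then show ?case by (simp add: abs_l2_add sq)
qed

section \<open>Oscillating approximate null pairs\<close>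

text \<open>Starting from the term of order $-k$ that cancels the leading amplitude of the source, each step
looks at the leading amplitude $w$ of the remaining error, of order $p$, and subtracts from $u$
the wave of order $p - (n + k)$ with amplitude $w / a_{n+k}$. Applying the operator to that
wave reproduces $w$ at order $p$, so the error drops by one order. The corrections have order
below $-k$ and leave the leading amplitude of $u$ unchanged. The error starts at order $n - 1$
and reaches order $-1$ after $n$ steps.\<close>

lemma wkb_null_solution:
  fixes a b :: "nat \<Rightarrow> real \<Rightarrow> complex"
  assumes K: "closed K"
    and a: "\<And>j. j \<le> n + k \<Longrightarrow> smooth (a j)" and b: "\<And>j. j \<le> n \<Longrightarrow> smooth (b j)"
    and nz: "\<And>x. a (n + k) x \<noteq> 0" and \<phi>: "smooth_supported K \<phi>"
  shows "\<exists>u. leading K (- int k) (\<lambda>x. (- b n x / a (n + k) x) * \<phi> x) u \<and>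
    oscillating K (- 1) (\<lambda>N x. diff_op (n + k) a (u N) x + diff_op n b (wave 0 \<phi> N) x)"
proof -
  define e where "e u N x = diff_op (n + k) a (u N) x + diff_op n b (wave 0 \<phi> N) x" for u N x
  have ia: "smooth (\<lambda>x. inverse (a (n + k) x))" by (intro smooth_inverse a nz order_refl)
  define w0 where "w0 x = (- b n x / a (n + k) x) * \<phi> x" for x
  have w0: "smooth_supported K w0"
  proof -
    have "smooth_supported K (\<lambda>x. ((-1) * b n x) * (inverse (a (n + k) x) * \<phi> x))"
      by (intro smooth_supported_mult smooth_cmult b ia \<phi> order_refl)
    then show ?thesis unfolding w0_def by (simp add: divide_inverse mult.assoc)
  qed
  have "\<exists>u. leading K (- int k) w0 u \<and> oscillating K (int n - 1 - int j) (e u)" for j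
  proof (induction j)
    case 0
    have "leading K (- int k + int (n + k)) (\<lambda>x. a (n + k) x * w0 x) (\<lambda>N. diff_op (n + k) a (wave (- int k) w0 N))"
      by (intro leading_diff_op leading_wave w0 K a)
    moreover have "leading K (0 + int n) (\<lambda>x. b n x * \<phi> x) (\<lambda>N. diff_op n b (wave 0 \<phi> N))"
      by (intro leading_diff_op leading_wave \<phi> K b)
    ultimately have "leading K (int n) (\<lambda>x. a (n + k) x * w0 x + b n x * \<phi> x) (e (wave (- int k) w0))"
      unfolding e_def by (intro leading_add) simp_all
    moreover have "(\<lambda>x. a (n + k) x * w0 x + b n x * \<phi> x) = (\<lambda>x. 0)"
      using nz by (simp add: w0_def fun_eq_iff)
    ultimately have "oscillating K (int n - 1) (e (wave (- int k) w0))"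
      by (simp add: leading_zero_iff)
    then show ?case using leading_wave[OF w0] by auto
  next
    case (Suc j)
    then obtain u where u: "leading K (- int k) w0 u" and eu: "oscillating K (int n - 1 - int j) (e u)"
      by blast
    define p where "p = int n - 1 - int j"
    obtain w where w: "leading K p w (e u)"
      using oscillating_imp_leading[OF eu] unfolding p_def by blast
    define t where "t = wave (p - int (n + k)) (\<lambda>x. inverse (a (n + k) x) * w x)"
    have wa: "smooth_supported K (\<lambda>x. inverse (a (n + k) x) * w x)"
      using w by (intro smooth_supported_mult ia) (simp add: leading_def)
    define u' where "u' N x = u N x - t N x" for N x
    have "oscillating K (- int k - 1) t"
      unfolding t_def by (rule oscillating_wave[OF wa]) (simp add: p_def)
    then have "leading K (- int k) (\<lambda>x. w0 x - 0) (\<lambda>N x. u N x - t N x)"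
      by (intro leading_diff u) (simp add: leading_zero_iff)
    then have u': "leading K (- int k) w0 u'" by (simp add: u'_def[abs_def])
    have "leading K (p - int (n + k) + int (n + k)) (\<lambda>x. a (n + k) x * (inverse (a (n + k) x) * w x))
        (\<lambda>N. diff_op (n + k) a (t N))"
      unfolding t_def by (intro leading_diff_op leading_wave wa K a)
    then have "leading K p w (\<lambda>N. diff_op (n + k) a (t N))"
      using nz by (simp add: mult.assoc[symmetric])
    then have "leading K p (\<lambda>x. w x - w x) (\<lambda>N x. e u N x - diff_op (n + k) a (t N) x)"
      by (intro leading_diff w)
    then have "oscillating K (p - 1) (\<lambda>N x. e u N x - diff_op (n + k) a (t N) x)"
      by (simp add: leading_zero_iff)
    moreover have "(\<lambda>N x. e u N x - diff_op (n + k) a (t N) x) = e u'"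
    proof (intro ext)
      fix N x
      have "smooth (u N)" "smooth (t N)"
        using leading_imp_oscillating[OF u] smooth_supported_wave[OF wa]
          oscillating_imp_smooth_supported smooth_supported_imp_smooth unfolding t_def by blast+
      then have "diff_op (n + k) a (u' N) x = diff_op (n + k) a (u N) x - diff_op (n + k) a (t N) x"
        unfolding u'_def[abs_def] by (simp only: diff_op_minus)
      then show "e u N x - diff_op (n + k) a (t N) x = e u' N x" by (simp add: e_def)
    qed
    ultimately have "oscillating K (int n - 1 - int (Suc j)) (e u')"
      by (simp add: p_def algebra_simps)
    then show ?case using u' by blast
  qed
  from this[of n] obtain u where "leading K (- int k) w0 u" "oscillating K (- 1) (e u)" by auto
  then show ?thesis unfolding e_def w0_def[abs_def] by blast
qed

text \<open>With $u$ and $v$ from the WKB construction, the first component has order $-1$ and tends to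
zero. In the second component the orders $-k$ of $u$ and $k$ of the operator add up to zero,
and the leading amplitudes combine to the reduced symbol times the bump, of norm at most
\<open>\<epsilon>\<close>. The coefficients here are those of the operator after the shift by the spectral
parameter.\<close>

lemma localized_approximate_null_pair:
  fixes a b c :: "nat \<Rightarrow> real \<Rightarrow> complex"
  assumes a: "\<And>j. j \<le> n + k \<Longrightarrow> smooth (a j)" and b: "\<And>j. j \<le> n \<Longrightarrow> smooth (b j)"
    and c: "\<And>j. j \<le> k \<Longrightarrow> smooth (c j)" and d: "smooth d"
    and nz: "\<And>x. a (n + k) x \<noteq> 0" and "\<alpha> < \<beta>" and \<epsilon>: "\<epsilon> > 0"
    and small: "\<And>x. x \<in> {\<alpha>..\<beta>} \<Longrightarrow> cmod (d x - b n x * c k x / a (n + k) x) \<le> \<epsilon>"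
  shows "\<exists>u v. smooth_supported {\<alpha>..\<beta>} u \<and> smooth_supported {\<alpha>..\<beta>} v \<and> norm (abs_l2 v) = 1 \<and>
    norm (abs_l2 (\<lambda>x. diff_op (n + k) a u x + diff_op n b v x),
      abs_l2 (\<lambda>x. diff_op k c u x + d x * v x)) \<le> 3 * \<epsilon>"
proof -
  let ?K = "{\<alpha>..\<beta>}"
  have K: "compact ?K" "closed ?K" by auto
  obtain \<phi> where \<phi>: "smooth_supported ?K \<phi>" "norm (abs_l2 \<phi>) = 1"
    using normalized_bump_exists[OF \<open>\<alpha> < \<beta>\<close>] by blast
  define v where "v = wave 0 \<phi>"
  obtain u where u: "leading ?K (- int k) (\<lambda>x. (- b n x / a (n + k) x) * \<phi> x) u"
    and e: "oscillating ?K (- 1) (\<lambda>N x. diff_op (n + k) a (u N) x + diff_op n b (v N) x)"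
    using wkb_null_solution[of ?K n k a b \<phi>, OF K(2) a b nz \<phi>(1)] unfolding v_def by blast
  define \<psi> where "\<psi> x = (d x - b n x * c k x / a (n + k) x) * \<phi> x" for x
  define g where "g N x = diff_op k c (u N) x + d x * v N x" for N x
  have "leading ?K (- int k + int k) (\<lambda>x. c k x * ((- b n x / a (n + k) x) * \<phi> x)) (\<lambda>N. diff_op k c (u N))"
    by (intro leading_diff_op u K c)
  moreover have "leading ?K 0 (\<lambda>x. d x * \<phi> x) (\<lambda>N x. d x * v N x)"
    unfolding v_def by (intro leading_mult leading_wave \<phi> d)
  ultimately have "leading ?K 0 (\<lambda>x. c k x * ((- b n x / a (n + k) x) * \<phi> x) + d x * \<phi> x) g"
    unfolding g_def[abs_def] by (intro leading_add) simp_all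
  moreover have "(\<lambda>x. c k x * ((- b n x / a (n + k) x) * \<phi> x) + d x * \<phi> x) = \<psi>"
    by (simp add: \<psi>_def fun_eq_iff algebra_simps)
  ultimately have g: "leading ?K 0 \<psi> g" by simp
  define r where "r N x = g N x - wave 0 \<psi> N x" for N x
  have \<psi>: "smooth_supported ?K \<psi>" and r: "oscillating ?K (- 1) r"
    using g unfolding leading_def r_def by auto
  have n\<psi>: "norm (abs_l2 \<psi>) \<le> \<epsilon>"
  proof -
    have "cmod (\<psi> x) \<le> \<epsilon> * cmod (\<phi> x)" for x
    proof (cases "x \<in> ?K")
      case True
      then show ?thesis unfolding \<psi>_def norm_mult by (intro mult_right_mono small) auto
    next
      case False
      then show ?thesis using \<phi>(1) by (simp add: \<psi>_def smooth_supported_outside)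
    qed
    then have "norm (abs_l2 \<psi>) \<le> \<epsilon> * norm (abs_l2 \<phi>)"
      using \<epsilon> \<phi>(1) \<psi> K by (intro norm_abs_l2_le smooth_supported_square_integrable) auto
    then show ?thesis using \<phi> by simp
  qed
  have "\<forall>\<^sub>F N in sequentially. norm (abs_l2 (\<lambda>x. diff_op (n + k) a (u N) x + diff_op n b (v N) x)) < \<epsilon>"
    using tendstoD[OF oscillating_negative_tendsto_0[OF K(1) e] \<epsilon>] by simp
  moreover have "\<forall>\<^sub>F N in sequentially. norm (abs_l2 (r N)) < \<epsilon>"
    using tendstoD[OF oscillating_negative_tendsto_0[OF K(1) r] \<epsilon>] by simp
  ultimately have "\<forall>\<^sub>F N in sequentially. norm (abs_l2 (\<lambda>x. diff_op (n + k) a (u N) x + diff_op n b (v N) x)) < \<epsilon> \<and>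
      norm (abs_l2 (r N)) < \<epsilon>" by (rule eventually_conj)
  then obtain N where N: "norm (abs_l2 (\<lambda>x. diff_op (n + k) a (u N) x + diff_op n b (v N) x)) < \<epsilon>"
    "norm (abs_l2 (r N)) < \<epsilon>"
    using eventually_happens'[OF sequentially_bot] by blast
  have "abs_l2 (g N) = abs_l2 (\<lambda>x. wave 0 \<psi> N x + r N x)" by (simp add: r_def)
  also have "\<dots> = abs_l2 (wave 0 \<psi> N) + abs_l2 (r N)"
    by (intro abs_l2_add[symmetric] smooth_supported_square_integrable[OF _ K(1)]
        smooth_supported_wave[OF \<psi>] oscillating_imp_smooth_supported[OF r])
  finally have "norm (abs_l2 (g N)) \<le> norm (abs_l2 (wave 0 \<psi> N)) + norm (abs_l2 (r N))"
    using norm_triangle_ineq by simp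
  then have gN: "norm (abs_l2 (g N)) \<le> 2 * \<epsilon>"
    using N n\<psi> norm_wave[OF \<psi> K(1), of 0 N] by simp
  have "norm (abs_l2 (\<lambda>x. diff_op (n + k) a (u N) x + diff_op n b (v N) x), abs_l2 (g N)) \<le> 3 * \<epsilon>"
    using norm_Pair_le[of "abs_l2 (\<lambda>x. diff_op (n + k) a (u N) x + diff_op n b (v N) x)" "abs_l2 (g N)"] N gN
    by linarith
  moreover have "norm (abs_l2 (v N)) = 1"
    using norm_wave[OF \<phi>(1) K(1), of 0 N] \<phi>(2) by (simp add: v_def)
  moreover have "smooth_supported ?K (u N)"
    using leading_imp_oscillating[OF u] by (rule oscillating_imp_smooth_supported)
  moreover have "smooth_supported ?K (v N)"
    unfolding v_def by (rule smooth_supported_wave[OF \<phi>(1)])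
  ultimately show ?thesis unfolding g_def by blast
qed

section \<open>The matrix differential operator and its essential spectrum\<close>

text \<open>Finitely many test functions vanish outside a common compact set, and so do their images under the
differential expressions. All functions involved are therefore square integrable, and the
linearity of the expressions passes to the classes.\<close>

lemma subspace_minimal_op:
  assumes a: "\<And>j. j \<le> n + k \<Longrightarrow> smooth (a j)" and b: "\<And>j. j \<le> n \<Longrightarrow> smooth (b j)"
    and c: "\<And>j. j \<le> k \<Longrightarrow> smooth (c j)" and d: "smooth d"
  shows "subspace (minimal_op n k a b c d)"
proof -
  define F where "F u v = (\<lambda>x. diff_op (n + k) a u x + diff_op n b v x)" for u v
  define G where "G u v = (\<lambda>x. diff_op k c u x + d x * v x)" for u v
  define P where "P u v = ((abs_l2 u, abs_l2 v), (abs_l2 (F u v), abs_l2 (G u v)))" for u v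
  have mem: "p \<in> minimal_op n k a b c d \<longleftrightarrow>
      (\<exists>u v K. compact K \<and> smooth_supported K u \<and> smooth_supported K v \<and> p = P u v)" for p
  proof
    assume "p \<in> minimal_op n k a b c d"
    then obtain u v where uv: "test_function u" "test_function v" "p = P u v"
      by (auto simp: minimal_op_def P_def F_def G_def)
    then obtain K L where "compact K" "smooth_supported K u" "compact L" "smooth_supported L v"
      by (auto simp: test_function_iff_smooth_supported)
    then have "compact (K \<union> L)" "smooth_supported (K \<union> L) u" "smooth_supported (K \<union> L) v"
      by (auto intro: smooth_supported_mono)
    then show "\<exists>u v K. compact K \<and> smooth_supported K u \<and> smooth_supported K v \<and> p = P u v"
      using uv by blast
  next
    assume "\<exists>u v K. compact K \<and> smooth_supported K u \<and> smooth_supported K v \<and> p = P u v"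
    then show "p \<in> minimal_op n k a b c d"
      unfolding minimal_op_def P_def F_def G_def using smooth_supported_imp_test_function by blast
  qed
  have FG: "smooth_supported K (F u v)" "smooth_supported K (G u v)"
    if "compact K" "smooth_supported K u" "smooth_supported K v" for K u v
    unfolding F_def G_def using that compact_imp_closed[OF that(1)]
    by (auto intro!: smooth_supported_add smooth_supported_mult smooth_supported_diff_op a b c d)
  have add: "P u v + P u' v' = P (\<lambda>x. u x + u' x) (\<lambda>x. v x + v' x)"
    if K: "compact K" and s: "smooth_supported K u" "smooth_supported K v" "smooth_supported K u'" "smooth_supported K v'"
    for K u v u' v'
  proof -
    have "F (\<lambda>x. u x + u' x) (\<lambda>x. v x + v' x) = (\<lambda>x. F u v x + F u' v' x)"
      "G (\<lambda>x. u x + u' x) (\<lambda>x. v x + v' x) = (\<lambda>x. G u v x + G u' v' x)"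
      using s[THEN smooth_supported_imp_smooth]
      by (simp_all add: F_def G_def diff_op_add algebra_simps fun_eq_iff)
    moreover have "square_integrable u" "square_integrable v" "square_integrable u'" "square_integrable v'"
      "square_integrable (F u v)" "square_integrable (F u' v')" "square_integrable (G u v)" "square_integrable (G u' v')"
      using s FG K smooth_supported_square_integrable by blast+
    ultimately show ?thesis by (simp add: P_def abs_l2_add)
  qed
  have scale: "t *\<^sub>R P u v = P (\<lambda>x. of_real t * u x) (\<lambda>x. of_real t * v x)"
    if K: "compact K" and s: "smooth_supported K u" "smooth_supported K v" for K u v t
  proof -
    have "F (\<lambda>x. of_real t * u x) (\<lambda>x. of_real t * v x) = (\<lambda>x. of_real t * F u v x)"
      "G (\<lambda>x. of_real t * u x) (\<lambda>x. of_real t * v x) = (\<lambda>x. of_real t * G u v x)"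
      using s[THEN smooth_supported_imp_smooth]
      by (simp_all add: F_def G_def diff_op_cmult algebra_simps fun_eq_iff)
    moreover have "square_integrable u" "square_integrable v"
      "square_integrable (F u v)" "square_integrable (G u v)"
      using s FG K smooth_supported_square_integrable by blast+
    ultimately show ?thesis by (simp add: P_def scaleR_eq_scaleC[of _ "abs_l2 _"] abs_l2_scaleC)
  qed
  show ?thesis
    unfolding subspace_def
  proof (intro conjI ballI allI)
    have "P (\<lambda>x. 0) (\<lambda>x. 0) \<in> minimal_op n k a b c d"
      using mem smooth_supported_zero compact_empty by blast
    moreover have "P (\<lambda>x. 0) (\<lambda>x. 0) = 0"
      using scale[of "{}" "\<lambda>x. 0" "\<lambda>x. 0" 0] by (simp add: smooth_supported_zero)
    ultimately show "0 \<in> minimal_op n k a b c d" by simp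
  next
    fix p q assume "p \<in> minimal_op n k a b c d" "q \<in> minimal_op n k a b c d"
    then obtain u v K u' v' L where 1: "compact K" "smooth_supported K u" "smooth_supported K v" "p = P u v"
      and 2: "compact L" "smooth_supported L u'" "smooth_supported L v'" "q = P u' v'"
      using mem by metis
    have KL: "compact (K \<union> L)" using 1 2 by auto
    have s: "smooth_supported (K \<union> L) u" "smooth_supported (K \<union> L) v"
      "smooth_supported (K \<union> L) u'" "smooth_supported (K \<union> L) v'"
      using 1 2 by (auto intro: smooth_supported_mono)
    then have "p + q = P (\<lambda>x. u x + u' x) (\<lambda>x. v x + v' x)"
      using add[OF KL] 1 2 by simp
    then show "p + q \<in> minimal_op n k a b c d"
      using mem KL s smooth_supported_add by blast
  next
    fix t p assume "p \<in> minimal_op n k a b c d"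
    then obtain u v K where 1: "compact K" "smooth_supported K u" "smooth_supported K v" "p = P u v"
      using mem by metis
    then have "t *\<^sub>R p = P (\<lambda>x. of_real t * u x) (\<lambda>x. of_real t * v x)" using scale by simp
    then show "t *\<^sub>R p \<in> minimal_op n k a b c d"
      using mem 1 smooth_supported_cmult by blast
  qed
qed

text \<open>The shift by \<open>z\<close> is absorbed into the zeroth coefficient of the first diagonal entry and into
\<open>d\<close>.\<close>

lemma op_shift_minimal_op:
  assumes a: "\<And>j. j \<le> n + k \<Longrightarrow> smooth (a j)" and b: "\<And>j. j \<le> n \<Longrightarrow> smooth (b j)"
    and c: "\<And>j. j \<le> k \<Longrightarrow> smooth (c j)" and d: "smooth d"
    and K: "compact K" and s: "smooth_supported K u" "smooth_supported K v"
  shows "((abs_l2 u, abs_l2 v),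
      (abs_l2 (\<lambda>x. diff_op (n + k) (a(0 := \<lambda>x. a 0 x - z)) u x + diff_op n b v x),
       abs_l2 (\<lambda>x. diff_op k c u x + (d x - z) * v x)))
    \<in> op_shift (op_closure (minimal_op n k a b c d)) z"
proof -
  have F: "smooth_supported K (\<lambda>x. diff_op (n + k) a u x + diff_op n b v x)"
    and G: "smooth_supported K (\<lambda>x. diff_op k c u x + d x * v x)"
    using compact_imp_closed[OF K] s
    by (auto intro!: smooth_supported_add smooth_supported_mult smooth_supported_diff_op a b c d)
  have sq: "square_integrable w" if "smooth_supported K w" for w
    using that K by (rule smooth_supported_square_integrable)
  have "(\<lambda>x. diff_op (n + k) (a(0 := \<lambda>x. a 0 x - z)) u x + diff_op n b v x) =
      (\<lambda>x. (diff_op (n + k) a u x + diff_op n b v x) - z * u x)"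
    by (simp add: diff_op_shift[OF refl] fun_eq_iff)
  then have 1: "abs_l2 (\<lambda>x. diff_op (n + k) (a(0 := \<lambda>x. a 0 x - z)) u x + diff_op n b v x) =
      abs_l2 (\<lambda>x. diff_op (n + k) a u x + diff_op n b v x) - z *\<^sub>C abs_l2 u"
    by (simp only: abs_l2_scaleC[OF sq[OF s(1)]] abs_l2_minus[OF sq[OF F] square_integrable_mult[OF sq[OF s(1)]]])
  have "(\<lambda>x. diff_op k c u x + (d x - z) * v x) = (\<lambda>x. (diff_op k c u x + d x * v x) - z * v x)"
    by (simp add: algebra_simps)
  then have 2: "abs_l2 (\<lambda>x. diff_op k c u x + (d x - z) * v x) =
      abs_l2 (\<lambda>x. diff_op k c u x + d x * v x) - z *\<^sub>C abs_l2 v"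
    by (simp only: abs_l2_scaleC[OF sq[OF s(2)]] abs_l2_minus[OF sq[OF G] square_integrable_mult[OF sq[OF s(2)]]])
  have "((abs_l2 u, abs_l2 v), (abs_l2 (\<lambda>x. diff_op (n + k) a u x + diff_op n b v x),
      abs_l2 (\<lambda>x. diff_op k c u x + d x * v x))) \<in> minimal_op n k a b c d"
    unfolding minimal_op_def using s K smooth_supported_imp_test_function by blast
  then show ?thesis
    unfolding op_shift_iff op_closure_def 1 2
    using closure_subset by (auto simp: scaleC_prod_def)
qed

text \<open>Pairs supported in disjoint sets are orthogonal even after multiplication by complex scalars, so
Pythagoras bounds the norm of the sum from below by each summand, in which the second component
alone already contributes the modulus of the coefficient.\<close>

lemma coefficient_le_norm_of_disjoint_sum:
  fixes u v :: "nat \<Rightarrow> real \<Rightarrow> complex"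
  assumes K: "\<And>j. compact (K j)" and disj: "\<And>i j. i \<noteq> j \<Longrightarrow> K i \<inter> K j = {}"
    and u: "\<And>j. smooth_supported (K j) (u j)" and v: "\<And>j. smooth_supported (K j) (v j)"
    and v1: "\<And>j. norm (abs_l2 (v j)) = 1" and i: "i \<le> N"
  shows "cmod (c i) \<le> norm (\<Sum>j\<le>N. c j *\<^sub>C (abs_l2 (u j), abs_l2 (v j)))"
proof -
  define f where "f j = c j *\<^sub>C (abs_l2 (u j), abs_l2 (v j))" for j
  have squ: "square_integrable (u j)" and sqv: "square_integrable (v j)" for j
    using smooth_supported_square_integrable K u v by blast+
  have fe: "f j = (abs_l2 (\<lambda>x. c j * u j x), abs_l2 (\<lambda>x. c j * v j x))" for j
    unfolding f_def scaleC_prod_def by (simp add: abs_l2_scaleC squ sqv)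
  have "f j \<bullet> f l = 0" if "j \<noteq> l" for j l
  proof -
    have "(x \<notin> K j) \<or> (x \<notin> K l)" for x using disj[OF that] by blast
    then have z: "u j x = 0 \<or> u l x = 0" "v j x = 0 \<or> v l x = 0" for x
      using u v smooth_supported_outside by metis+
    have 0: "c j * u j x = 0 \<or> c l * u l x = 0" "c j * v j x = 0 \<or> c l * v l x = 0" for x
      using z[of x] by auto
    have "abs_l2 (\<lambda>x. c j * u j x) \<bullet> abs_l2 (\<lambda>x. c l * u l x) = 0"
      by (intro inner_abs_l2_disjoint square_integrable_mult squ 0)
    moreover have "abs_l2 (\<lambda>x. c j * v j x) \<bullet> abs_l2 (\<lambda>x. c l * v l x) = 0"
      by (intro inner_abs_l2_disjoint square_integrable_mult sqv 0)
    ultimately show ?thesis unfolding fe inner_prod_def by simp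
  qed
  then have "(norm (\<Sum>j\<le>N. f j))\<^sup>2 = (\<Sum>j\<le>N. (norm (f j))\<^sup>2)"
    by (intro norm_sum_Pythagorean) (auto simp: pairwise_def orthogonal_def)
  moreover have "(norm (f i))\<^sup>2 \<le> (\<Sum>j\<le>N. (norm (f j))\<^sup>2)"
    using i by (intro member_le_sum) auto
  ultimately have "(norm (f i))\<^sup>2 \<le> (norm (\<Sum>j\<le>N. f j))\<^sup>2"
    by (simp only:)
  then have "norm (f i) \<le> norm (\<Sum>j\<le>N. f j)"
    by (rule power2_le_imp_le) simp
  moreover have "cmod (c i) \<le> norm (f i)"
    using norm_snd_le[where x = "abs_l2 (u i)" and y = "abs_l2 (v i)"] v1[of i]
    by (simp add: f_def norm_scaleC mult_le_cancel_left1)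
  ultimately show ?thesis by (simp add: f_def)
qed

text \<open>The determinant factors into $a_{n+k}(x)\, \xi^{n+k}$, which does not vanish for nonzero
frequencies, and the reduced symbol.\<close>

lemma dn_elliptic_iff:
  assumes nz: "\<And>x. a (n + k) x \<noteq> 0"
  shows "dn_elliptic n k a b c d z \<longleftrightarrow> (\<forall>x. d x - z - b n x * c k x / a (n + k) x \<noteq> 0)"
proof -
  have "det (dn_symbol n k a b c d z x \<xi>) =
      a (n + k) x * of_real \<xi> ^ (n + k) * (d x - z - b n x * c k x / a (n + k) x)" for x \<xi>
    using nz[of x] by (simp add: det_2 dn_symbol_def power_add field_simps)
  then show ?thesis using nz by (auto simp: dn_elliptic_def intro: exI[of _ 1])
qed

theorem theorem4p1:
  fixes n k :: nat
    and a b c :: "nat \<Rightarrow> real \<Rightarrow> complex"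
    and d :: "real \<Rightarrow> complex"
  assumes "0 < n + k" and "even (n + k)"
    and "\<And>j. j \<le> n + k \<Longrightarrow> smooth (a j)"
    and "\<And>j. j \<le> n \<Longrightarrow> smooth (b j)"
    and "\<And>j. j \<le> k \<Longrightarrow> smooth (c j)"
    and "smooth d"
    and "\<And>x. a (n + k) x \<noteq> 0"
  shows "{z. \<not> dn_elliptic n k a b c d z} \<subseteq> ess_spectrum (op_closure (minimal_op n k a b c d))"
proof
  note a = assms(3) and b = assms(4) and c = assms(5) and d = assms(6) and nz = assms(7)
  fix z assume "z \<in> {z. \<not> dn_elliptic n k a b c d z}"
  then obtain x\<^sub>0 where x0: "d x\<^sub>0 - z - b n x\<^sub>0 * c k x\<^sub>0 / a (n + k) x\<^sub>0 = 0"
    using dn_elliptic_iff[of a n k, OF nz] by auto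
  define T where "T = op_shift (op_closure (minimal_op n k a b c d)) z"
  define a' where "a' = a(0 := \<lambda>x. a 0 x - z)"
  have a': "smooth (a' j)" if "j \<le> n + k" for j
    using a that by (auto simp: a'_def intro: smooth_diff smooth_const)
  \<comment> \<open>The order is positive, so the shift leaves the top coefficient alone.\<close>
  have a'm: "a' (n + k) = a (n + k)" using assms(1) by (auto simp: a'_def)
  have d': "smooth (\<lambda>x. d x - z)" by (intro smooth_diff d smooth_const)
  have "\<not> fredholm T"
  proof (rule not_fredholm_if_singular_families)
    show "subspace T" unfolding T_def op_closure_def
      by (intro subspace_op_shift closure_subspace_real subspace_minimal_op a b c d)
    show "closed T" unfolding T_def op_closure_def by (intro closed_op_shift closed_closure)
    fix N :: nat and \<epsilon> :: real assume \<epsilon>: "\<epsilon> > 0"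
    have "continuous_on UNIV (\<lambda>x. d x - z - b n x * c k x / a (n + k) x)"
      using a b c d nz by (intro continuous_intros smooth_continuous_on) auto
    then have "isCont (\<lambda>x. d x - z - b n x * c k x / a (n + k) x) x\<^sub>0"
      by (simp only: continuous_on_eq_continuous_at[OF open_UNIV] ball_UNIV)
    then have "((\<lambda>x. d x - z - b n x * c k x / a (n + k) x) \<longlongrightarrow> 0) (at x\<^sub>0)"
      unfolding isCont_def x0 .
    then have "\<forall>\<^sub>F x in at x\<^sub>0. dist (d x - z - b n x * c k x / a (n + k) x) 0 < \<epsilon> / 3"
      using \<epsilon> by (intro tendstoD) auto
    then obtain \<delta> where \<delta>: "\<delta> > 0"
      "\<And>x. x \<noteq> x\<^sub>0 \<Longrightarrow> dist x x\<^sub>0 < \<delta> \<Longrightarrow> cmod (d x - z - b n x * c k x / a (n + k) x) < \<epsilon> / 3"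
      unfolding eventually_at by auto
    \<comment> \<open>Disjoint compact intervals, all to the right of \<open>x\<^sub>0\<close> and within distance \<open>\<delta>\<close> of it.\<close>
    define \<alpha> \<beta> where "\<alpha> j = x\<^sub>0 + \<delta> / (2 * real j + 3)" and "\<beta> j = x\<^sub>0 + \<delta> / (2 * real j + 2)" for j
    have ab: "x\<^sub>0 < \<alpha> j" "\<alpha> j < \<beta> j" "\<beta> j < x\<^sub>0 + \<delta>" for j
    proof -
      have "\<delta> / (2 * real j + 3) < \<delta> / (2 * real j + 2)"
        using \<delta>(1) by (intro divide_strict_left_mono) auto
      moreover have "\<delta> / (2 * real j + 2) < \<delta> / 1"
        using \<delta>(1) by (intro divide_strict_left_mono) auto
      ultimately show "x\<^sub>0 < \<alpha> j" "\<alpha> j < \<beta> j" "\<beta> j < x\<^sub>0 + \<delta>"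
        using \<delta>(1) by (auto simp: \<alpha>_def \<beta>_def)
    qed
    define good where "good j u v \<longleftrightarrow>
        smooth_supported {\<alpha> j..\<beta> j} u \<and> smooth_supported {\<alpha> j..\<beta> j} v \<and> norm (abs_l2 v) = 1 \<and>
        norm (abs_l2 (\<lambda>x. diff_op (n + k) a' u x + diff_op n b v x),
          abs_l2 (\<lambda>x. diff_op k c u x + (d x - z) * v x)) \<le> 3 * (\<epsilon> / 3)" for j u v
    have "\<exists>u v. good j u v" for j
      unfolding good_def
    proof (rule localized_approximate_null_pair)
      show "cmod (d x - z - b n x * c k x / a' (n + k) x) \<le> \<epsilon> / 3" if "x \<in> {\<alpha> j..\<beta> j}" for x
        unfolding a'm using that ab[of j] by (intro less_imp_le \<delta>(2)) (auto simp: dist_real_def)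
    qed (use a' b c d' nz ab \<epsilon> in \<open>simp_all add: a'm\<close>)
    then obtain u v where "\<And>j. good j (u j) (v j)"
      by metis
    then have u: "\<And>j. smooth_supported {\<alpha> j..\<beta> j} (u j)"
      and v: "\<And>j. smooth_supported {\<alpha> j..\<beta> j} (v j)" and v1: "\<And>j. norm (abs_l2 (v j)) = 1"
      and small: "\<And>j. norm (abs_l2 (\<lambda>x. diff_op (n + k) a' (u j) x + diff_op n b (v j) x),
          abs_l2 (\<lambda>x. diff_op k c (u j) x + (d x - z) * v j x)) \<le> 3 * (\<epsilon> / 3)"
      by (simp_all only: good_def)
    have lt: "\<beta> j < \<alpha> i" if "i < j" for i j
    proof -
      have "2 * real i + 3 < 2 * real j + 2" using that by linarith
      then have "\<delta> / (2 * real j + 2) < \<delta> / (2 * real i + 3)"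
        using \<delta>(1) by (intro divide_strict_left_mono mult_pos_pos) linarith+
      then show ?thesis by (simp add: \<alpha>_def \<beta>_def)
    qed
    have disj: "{\<alpha> i..\<beta> i} \<inter> {\<alpha> j..\<beta> j} = {}" if "i \<noteq> j" for i j
      using that lt[of i j] lt[of j i] by (cases "i < j") auto
    show "\<exists>f g. (\<forall>i\<le>N. (f i, g i) \<in> T \<and> norm (g i) \<le> \<epsilon>) \<and>
        (\<forall>c. \<forall>i\<le>N. cmod (c i) \<le> norm (\<Sum>j\<le>N. c j *\<^sub>C f j))"
    proof (intro exI conjI allI impI)
      show "((abs_l2 (u i), abs_l2 (v i)),
          (abs_l2 (\<lambda>x. diff_op (n + k) a' (u i) x + diff_op n b (v i) x),
           abs_l2 (\<lambda>x. diff_op k c (u i) x + (d x - z) * v i x))) \<in> T" for i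
        unfolding T_def a'_def by (rule op_shift_minimal_op[OF a b c d _ u v]) auto
      show "norm (abs_l2 (\<lambda>x. diff_op (n + k) a' (u i) x + diff_op n b (v i) x),
           abs_l2 (\<lambda>x. diff_op k c (u i) x + (d x - z) * v i x)) \<le> \<epsilon>" for i
        using small[of i] by simp
      show "cmod (h i) \<le> norm (\<Sum>j\<le>N. h j *\<^sub>C (abs_l2 (u j), abs_l2 (v j)))" if "i \<le> N" for h i
        by (rule coefficient_le_norm_of_disjoint_sum[OF _ disj u v v1 that]) auto
    qed
  qed
  then show "z \<in> ess_spectrum (op_closure (minimal_op n k a b c d))"
    by (simp add: ess_spectrum_def T_def)
qed

end
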